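(* Let $F:\mathbb{R}^m\to\mathcal{P}(\mathbb{R}^n)$ be an outer semi-continuous definable multifunction with compact values. For $a\in\mathrm{dom}\,F$ there exists a definable $\varphi\in\Phi_p$ such that $$\mathrm{dist}_H(F(x),F(a))\ge\varphi\big(d(x,F_*(F(a)))\big),\qquad x\in K,$$ where $K$ is a compact neighbourhood of $a$ such that $K\subset\mathrm{dom}\,F$, and $F_*(F(a))=\{x\in\mathbb{R}^m: F(a)\subset F(x)\}$ is the upper preimage.
   Context: Definable means definable in some o-minimal structure on the real field $(\mathbb{R},+,\cdot)$. A multifunction is a map $F:\mathbb{R}^m\to\mathcal{P}(\mathbb{R}^n)$; its domain is $\mathrm{dom}\,F=\{x: F(x)\ne\emptyset\}$, and it is definable if its graph $\{(x,y)\in\mathbb{R}^m\times\mathbb{R}^n: y\in F(x)\}$ is a definable set. For $b\in\overline{\mathrm{dom}\,F\setminus\{b\}}$, the Kuratowski upper limit $\limsup_{x\to b}F(x)$ is the set of $y$ for which there exist a sequence $x_\nu\in\mathrm{dom}\,F\setminus\{b\}$, $x_\nu\to b$, and $y_\nu\in F(x_\nu)$ with $y_\nu\to y$. $F$ is outer semi-continuous at $b\in\mathrm{dom}\,F$ when $\limsup_{x\to b}F(x)\subset F(b)$, and outer semi-continuous when this holds at the points $b$ of $\mathrm{dom}\,F$. $d(x,S)$ is the Euclidean distance from $x$ to $S$. For non-empty compact sets $A,B$, $\mathrm{dist}_H(A,B)=\max\{\max_{x\in A}d(x,B),\max_{x\in B}d(x,A)\}$. $p\ge1$ is any integer fixed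 a priori, and $\Phi_p$ is the set of all odd, increasing bijections $\phi:\mathbb{R}\to\mathbb{R}$ of class $\mathcal{C}^p$ with $\phi^{(k)}(0)=0$ for $k\in\{1,\dots,p\}$.
   Formalization: K is assumed definable in the same o-minimal structure as F and φ; for an arbitrary compact neighbourhood K ⊂ dom F the inequality can fail (K may approach a boundary point of dom F along an exponentially flat sequence while φ is semialgebraic). *)

theory Defs
  imports "HOL-Analysis.Analysis"
begin

section \<open>O-minimal structures on the real field\<close>

text \<open>
  A point of the \<open>n\<close>-dimensional real space is a list of length \<open>n\<close>, since \<open>n\<close> varies within
  the axioms; \<open>S n\<close> is the collection of definable subsets. The last axiom says that \<open>S 1\<close>
  consists exactly of the finite unions of intervals of all kinds (a singleton is an interval), so
  all real parameters are allowed. Together with the graphs of addition and multiplication this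
  makes all semialgebraic sets definable.
\<close>

locale o_minimal_structure =
  fixes S :: "nat \<Rightarrow> real list set set"
  assumes length_eq: "\<And>n A xs. A \<in> S n \<Longrightarrow> xs \<in> A \<Longrightarrow> length xs = n"
    and whole_space: "\<And>n. {xs. length xs = n} \<in> S n"
    and complement: "\<And>n A. A \<in> S n \<Longrightarrow> {xs. length xs = n} - A \<in> S n"
    and union: "\<And>n A B. A \<in> S n \<Longrightarrow> B \<in> S n \<Longrightarrow> A \<union> B \<in> S n"
    and times_line: "\<And>n A. A \<in> S n \<Longrightarrow> {xs @ [t] |xs t. xs \<in> A} \<in> S (Suc n)"
    and line_times: "\<And>n A. A \<in> S n \<Longrightarrow> {t # xs |t xs. xs \<in> A} \<in> S (Suc n)"
    and diagonal: "\<And>n i j. i < n \<Longrightarrow> j < n \<Longrightarrow> {xs. length xs = n \<and> xs ! i = xs ! j} \<in> S n"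
    and projection: "\<And>n A. A \<in> S (Suc n) \<Longrightarrow> butlast ` A \<in> S n"
    and addition: "{[x, y, x + y] |x y. True} \<in> S 3"
    and multiplication: "{[x, y, x * y] |x y. True} \<in> S 3"
    and o_minimal: "\<And>A. (\<lambda>x. [x]) ` A \<in> S 1 \<longleftrightarrow> (\<exists>\<I>. finite \<I> \<and> (\<forall>I\<in>\<I>. is_interval I) \<and> A = \<Union>\<I>)"

text \<open>
  Subsets of a Euclidean space are transported to lists by means of the coordinates in the standard
  basis. The order in which the basis is enumerated is irrelevant, because a structure is
  closed under permutations of the coordinates.
\<close>

definition definable :: "(nat \<Rightarrow> real list set set) \<Rightarrow> 'a::euclidean_space set \<Rightarrow> bool" where
  "definable S A \<longleftrightarrow>
    (\<exists>bs. distinct bs \<and> set bs = (Basis :: 'a set) \<and> (\<lambda>x. map (\<lambda>b. x \<bullet> b) bs) ` A \<in> S DIM('a))"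

definition definable_fun ::
    "(nat \<Rightarrow> real list set set) \<Rightarrow> ('a::euclidean_space \<Rightarrow> 'b::euclidean_space) \<Rightarrow> bool" where
  "definable_fun S f \<longleftrightarrow> definable S {(x, y). y = f x}"


section \<open>Multifunctions\<close>

definition definable_multifun ::
    "(nat \<Rightarrow> real list set set) \<Rightarrow> ('a::euclidean_space \<Rightarrow> 'b::euclidean_space set) \<Rightarrow> bool" where
  "definable_multifun S F \<longleftrightarrow> definable S {(x, y). y \<in> F x}"

definition mdom :: "('a \<Rightarrow> 'b set) \<Rightarrow> 'a set" where
  "mdom F = {x. F x \<noteq> {}}"

text \<open>
  The upper limit is only of interest for \<open>b \<in> closure (mdom F - {b})\<close>; otherwise it is empty and
  outer semi-continuity at \<open>b\<close> holds trivially.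
\<close>

definition kuratowski_limsup ::
    "('a::topological_space \<Rightarrow> 'b::topological_space set) \<Rightarrow> 'a \<Rightarrow> 'b set" where
  "kuratowski_limsup F b =
    {y. \<exists>xs ys. (\<forall>\<nu>::nat. xs \<nu> \<in> mdom F - {b} \<and> ys \<nu> \<in> F (xs \<nu>))
          \<and> xs \<longlonglongrightarrow> b \<and> ys \<longlonglongrightarrow> y}"

definition outer_semicontinuous ::
    "('a::topological_space \<Rightarrow> 'b::topological_space set) \<Rightarrow> bool" where
  "outer_semicontinuous F \<longleftrightarrow> (\<forall>b\<in>mdom F. kuratowski_limsup F b \<subseteq> F b)"

definition upper_preimage :: "('a \<Rightarrow> 'b set) \<Rightarrow> 'b set \<Rightarrow> 'a set" where
  "upper_preimage F B = {x. B \<subseteq> F x}"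

text \<open>Meaningful for non-empty compact sets, where both suprema are attained.\<close>

definition hausdorff_dist :: "'a::metric_space set \<Rightarrow> 'a set \<Rightarrow> real" where
  "hausdorff_dist A B = max (SUP x\<in>A. infdist x B) (SUP x\<in>B. infdist x A)"


section \<open>The class \<open>\<Phi>\<^sub>p\<close>\<close>

definition of_class_C :: "nat \<Rightarrow> (real \<Rightarrow> real) \<Rightarrow> bool" where
  "of_class_C p f \<longleftrightarrow>
    (\<forall>k<p. \<forall>x. (deriv ^^ k) f field_differentiable at x) \<and> continuous_on UNIV ((deriv ^^ p) f)"

definition Phi :: "nat \<Rightarrow> (real \<Rightarrow> real) set" where
  "Phi p = {\<phi>. (\<forall>t. \<phi> (- t) = - \<phi> t) \<and> strict_mono \<phi> \<and> bij \<phi> \<and> of_class_C p \<phi>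
                \<and> (\<forall>k\<in>{1..p}. (deriv ^^ k) \<phi> 0 = 0)}"

end

theory Submission
  imports Defs
begin

text \<open>
  Let \<open>U\<close> be the upper preimage of \<open>F a\<close>. By outer semi-continuity the excess of \<open>F a\<close> over
  \<open>F x\<close> is a lower semicontinuous function of \<open>x\<close> that vanishes exactly on \<open>U\<close>, so on the compact
  set of those \<open>x \<in> K\<close> with distance at least \<open>t > 0\<close> to \<open>U\<close> it is bounded below by some
  \<open>m t > 0\<close>, and \<open>m\<close> can be chosen definable, increasing and at most \<open>1\<close>. It remains to find a definable
  \<open>\<phi> \<in> \<Phi>\<^sub>p\<close> below \<open>m\<close> on a bounded interval \<open>(0, M]\<close>.

  A definable function is \<open>p + 1\<close> times differentiable on some \<open>(0, \<epsilon>)\<close>. Over the reals this has a short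
  proof: the one-sided derivatives exist in the extended reals by o-minimality, they agree outside
  a countable set (a point with left derivative below \<open>q\<close> and right derivative above \<open>q\<close> is a strict
  local minimum of \<open>f x - q x\<close>), and they cannot be infinite on an interval. Hence
  \<open>\<phi> t = (t / M) ^ (p + 1) * m (\<epsilon> t / (1 + t))\<close>, extended to an odd function, is \<open>p + 1\<close> times
  differentiable for \<open>t \<noteq> 0\<close>. At the origin no computation is needed: a definable \<open>g\<close> with
  \<open>g t = O(t ^ (n + 1))\<close> has \<open>g' t = O(t ^ n)\<close>, because \<open>g'\<close> is monotone near \<open>0\<close>.
\<close>

section \<open>Definable sets and functions\<close>

context o_minimal_structure
begin

lemma S_subset: "A \<in> S n \<Longrightarrow> A \<subseteq> {xs. length xs = n}"
  using length_eq by blast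

lemma S_Int:
  assumes "A \<in> S n" "B \<in> S n"
  shows "A \<inter> B \<in> S n"
proof -
  have "A \<inter> B = {xs. length xs = n} - (({xs. length xs = n} - A) \<union> ({xs. length xs = n} - B))"
    using S_subset[OF assms(1)] by blast
  then show ?thesis
    by (metis assms complement union)
qed

lemma S_prepend:
  assumes "A \<in> S m"
  shows "{xs @ ys |xs ys. length xs = n \<and> ys \<in> A} \<in> S (n + m)"
proof (induction n)
  case 0
  then show ?case using assms by simp
next
  case (Suc n)
  have "{xs @ ys |xs ys. length xs = Suc n \<and> ys \<in> A}
      = {t # zs |t zs. zs \<in> {xs @ ys |xs ys. length xs = n \<and> ys \<in> A}}"
    (is "?L = ?R")
  proof (intro equalityI subsetI)
    fix zs assume "zs \<in> ?L"
    then obtain t xs ys where "zs = t # (xs @ ys)" "length xs = n" "ys \<in> A"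
      by (auto simp: length_Suc_conv)
    then show "zs \<in> ?R" by blast
  next
    fix zs assume "zs \<in> ?R"
    then obtain t xs ys where "zs = (t # xs) @ ys" "length xs = n" "ys \<in> A"
      by auto
    then show "zs \<in> ?L" by (metis (mono_tags, lifting) length_Cons mem_Collect_eq)
  qed
  then show ?case using line_times[OF Suc] by simp
qed

lemma S_take:
  assumes "A \<in> S (n + m)"
  shows "take n ` A \<in> S n"
  using assms
proof (induction m arbitrary: A)
  case 0
  then have "take n ` A = A"
    using S_subset by force
  then show ?case using 0 by simp
next
  case (Suc m)
  then have "butlast ` A \<in> S (n + m)"
    using projection by simp
  moreover have "take n ` butlast ` A = take n ` A"
    using S_subset[OF Suc.prems]
    by (auto simp: image_image intro!: image_cong simp: take_butlast)
  ultimately show ?case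
    using Suc.IH by metis
qed

lemma S_finite_Int:
  assumes "finite I" "\<And>i. i \<in> I \<Longrightarrow> {xs. length xs = n \<and> P i xs} \<in> S n"
  shows "{xs. length xs = n \<and> (\<forall>i\<in>I. P i xs)} \<in> S n"
  using assms
proof (induction I rule: finite_induct)
  case empty
  then show ?case using whole_space by simp
next
  case (insert i I)
  have "{xs. length xs = n \<and> (\<forall>i\<in>insert i I. P i xs)} =
      {xs. length xs = n \<and> P i xs} \<inter> {xs. length xs = n \<and> (\<forall>i\<in>I. P i xs)}"
    by auto
  then show ?case using insert S_Int by simp
qed

text \<open>Cut \<open>\<real>\<^sup>n \<times> A\<close> by the diagonals that tie the last \<open>m\<close> coordinates to the selected ones, then
  project.\<close>

lemma S_select_coordinates:
  assumes A: "A \<in> S m" and i: "\<And>k. k < m \<Longrightarrow> i k < n"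
  shows "{xs. length xs = n \<and> map (\<lambda>k. xs ! i k) [0..<m] \<in> A} \<in> S n"
proof -
  let ?B = "{xs @ ys |xs ys. length xs = n \<and> ys \<in> A}"
  let ?C = "{zs. length zs = n + m \<and> (\<forall>k\<in>{..<m}. zs ! (n + k) = zs ! i k)}"
  have "?C \<in> S (n + m)"
    by (intro S_finite_Int diagonal) (use i in \<open>auto simp: trans_less_add1\<close>)
  then have "take n ` (?B \<inter> ?C) \<in> S n"
    using S_prepend[OF A] S_Int S_take by blast
  moreover have "take n ` (?B \<inter> ?C) = {xs. length xs = n \<and> map (\<lambda>k. xs ! i k) [0..<m] \<in> A}"
    (is "?L = ?R")
  proof (intro equalityI subsetI)
    fix xs assume "xs \<in> ?L"
    then obtain ys where *: "length xs = n" "ys \<in> A" "xs @ ys \<in> ?C"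
      by auto
    then have "length ys = m" using length_eq A by blast
    moreover have "ys ! k = xs ! i k" if "k < m" for k
    proof -
      have "(xs @ ys) ! (n + k) = (xs @ ys) ! i k" using * that by auto
      then show ?thesis using *(1) i[OF that] by (simp add: nth_append)
    qed
    ultimately have "map (\<lambda>k. xs ! i k) [0..<m] = ys"
      by (intro nth_equalityI) auto
    then show "xs \<in> ?R" using * by simp
  next
    fix xs assume *: "xs \<in> ?R"
    let ?ys = "map (\<lambda>k. xs ! i k) [0..<m]"
    have "xs @ ?ys \<in> ?B \<inter> ?C"
      using * i by (auto simp: nth_append)
    moreover have "xs = take n (xs @ ?ys)" using * by simp
    ultimately show "xs \<in> ?L" by (rule rev_image_eqI)
  qed
  ultimately show ?thesis by simp
qed

end

section \<open>Coordinates with respect to an enumerated basis\<close>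

definition coords :: "'a::euclidean_space list \<Rightarrow> 'a \<Rightarrow> real list" where
  "coords bs x = map (\<lambda>b. x \<bullet> b) bs"

definition basis_list :: "'a::euclidean_space list \<Rightarrow> bool" where
  "basis_list bs \<longleftrightarrow> distinct bs \<and> set bs = Basis"

lemma basis_list_exists: "\<exists>bs :: 'a::euclidean_space list. basis_list bs"
  using finite_distinct_list[OF finite_Basis] unfolding basis_list_def by metis

lemma length_basis_list: "basis_list (bs :: 'a::euclidean_space list) \<Longrightarrow> length bs = DIM('a)"
  unfolding basis_list_def by (metis distinct_card)

lemma coords_inj:
  assumes "basis_list bs"
  shows "coords bs x = coords bs y \<longleftrightarrow> x = y"
  using assms unfolding coords_def basis_list_def by (auto intro: euclidean_eqI)

lemma coords_surj:
  fixes bs :: "'a::euclidean_space list"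
  assumes bs: "basis_list bs" and len: "length xs = DIM('a)"
  obtains x where "coords bs x = xs"
proof
  \<comment> \<open>The coefficient at \<open>b\<close> is the entry of \<open>xs\<close> at the
    position of \<open>b\<close> in \<open>bs\<close>.\<close>
  let ?f = "\<lambda>b. xs ! (SOME k. k < length bs \<and> bs ! k = b)"
  let ?x = "\<Sum>b\<in>Basis. ?f b *\<^sub>R b"
  have "?x \<bullet> (bs ! k) = xs ! k" if k: "k < length bs" for k
  proof -
    have "bs ! k \<in> Basis" using bs k unfolding basis_list_def by (metis nth_mem)
    then have "?x \<bullet> (bs ! k) = ?f (bs ! k)"
      by (simp add: inner_sum_left_Basis)
    also have "(SOME j. j < length bs \<and> bs ! j = bs ! k) = k"
      using bs k by (intro some_equality) (auto simp: basis_list_def nth_eq_iff_index_eq)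
    finally show ?thesis .
  qed
  then show "coords bs ?x = xs"
    unfolding coords_def using len length_basis_list[OF bs] by (intro nth_equalityI) auto
qed

text \<open>These maps only rearrange, drop or repeat coordinates. Substituting one into a definable
  predicate amounts to renaming the variables of a formula, and this is available before
  compositions of general definable functions are.\<close>

definition coordinate_map :: "('a::euclidean_space \<Rightarrow> 'b::euclidean_space) \<Rightarrow> bool" where
  "coordinate_map h \<longleftrightarrow> (\<forall>b\<in>Basis. \<exists>c\<in>Basis. \<forall>x. h x \<bullet> b = x \<bullet> c)"

lemma coordinate_map_ident: "coordinate_map (\<lambda>x. x)"
  unfolding coordinate_map_def by blast

lemma coordinate_map_fst:
  fixes f :: "'c::euclidean_space \<Rightarrow> 'a::euclidean_space \<times> 'b::euclidean_space"
  assumes "coordinate_map f"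
  shows "coordinate_map (\<lambda>x. fst (f x))"
  unfolding coordinate_map_def
proof
  fix b :: 'a assume "b \<in> Basis"
  then have "(b, 0 :: 'b) \<in> Basis" by (simp add: Basis_prod_def)
  with assms obtain c where "c \<in> Basis" "\<And>x. f x \<bullet> (b, 0 :: 'b) = x \<bullet> c"
    unfolding coordinate_map_def by blast
  then show "\<exists>c\<in>Basis. \<forall>x. fst (f x) \<bullet> b = x \<bullet> c"
    by (auto simp: inner_prod_def)
qed

lemma coordinate_map_snd:
  fixes f :: "'c::euclidean_space \<Rightarrow> 'a::euclidean_space \<times> 'b::euclidean_space"
  assumes "coordinate_map f"
  shows "coordinate_map (\<lambda>x. snd (f x))"
  unfolding coordinate_map_def
proof
  fix b :: 'b assume "b \<in> Basis"
  then have "(0 :: 'a, b) \<in> Basis" by (simp add: Basis_prod_def)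
  with assms obtain c where "c \<in> Basis" "\<And>x. f x \<bullet> (0 :: 'a, b) = x \<bullet> c"
    unfolding coordinate_map_def by blast
  then show "\<exists>c\<in>Basis. \<forall>x. snd (f x) \<bullet> b = x \<bullet> c"
    by (auto simp: inner_prod_def)
qed

lemma coordinate_map_Pair:
  assumes "coordinate_map f" "coordinate_map g"
  shows "coordinate_map (\<lambda>x. (f x, g x))"
  using assms unfolding coordinate_map_def by (auto simp: Basis_prod_def)

lemma coordinate_map_inner:
  assumes "coordinate_map f" "b \<in> Basis"
  shows "coordinate_map (\<lambda>x. f x \<bullet> b)"
  using assms unfolding coordinate_map_def by auto

lemmas coordinate_map_intros = coordinate_map_ident coordinate_map_fst coordinate_map_snd
  coordinate_map_Pair coordinate_map_inner

section \<open>Transport of the axioms to Euclidean spaces\<close>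

context o_minimal_structure
begin

lemma definable_altdef:
  "definable S A \<longleftrightarrow> (\<exists>bs. basis_list bs \<and> coords bs ` A \<in> S DIM('a::euclidean_space))"
  for A :: "'a::euclidean_space set"
  unfolding definable_def basis_list_def coords_def by (simp add: conj_assoc)

text \<open>Every coordinate of \<open>h x\<close> is a coordinate of \<open>x\<close>, so the
  preimage is obtained by selecting coordinates. The enumeration \<open>bs\<close> is arbitrary
  here, whereas \<open>definable\<close> provides just one.\<close>

lemma coords_vimage_coordinate_map:
  fixes A :: "'b::euclidean_space set" and h :: "'a::euclidean_space \<Rightarrow> 'b"
  assumes A: "definable S A" and h: "coordinate_map h" and bs: "basis_list bs"
  shows "coords bs ` {x. h x \<in> A} \<in> S DIM('a)"
proof -
  obtain cs where cs: "basis_list cs" "coords cs ` A \<in> S DIM('b)"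
    using A unfolding definable_altdef by blast
  have "\<exists>i < DIM('a). \<forall>x. h x \<bullet> (cs ! k) = coords bs x ! i" if "k < DIM('b)" for k
  proof -
    have "cs ! k \<in> Basis"
      using cs(1) that length_basis_list[OF cs(1)] unfolding basis_list_def by (metis nth_mem)
    then obtain c where c: "c \<in> Basis" "\<And>x. h x \<bullet> (cs ! k) = x \<bullet> c"
      using h unfolding coordinate_map_def by metis
    then obtain i where "i < DIM('a)" "bs ! i = c"
      using bs length_basis_list[OF bs] unfolding basis_list_def by (metis in_set_conv_nth)
    then show ?thesis
      using c(2) length_basis_list[OF bs] unfolding coords_def by (metis nth_map)
  qed
  then obtain i where i: "\<And>k. k < DIM('b) \<Longrightarrow> i k < DIM('a)"
    "\<And>k x. k < DIM('b) \<Longrightarrow> h x \<bullet> (cs ! k) = coords bs x ! i k"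
    by metis
  have hi: "coords cs (h x) = map (\<lambda>k. coords bs x ! i k) [0..<DIM('b)]" for x
    using i(2) length_basis_list[OF cs(1)] by (intro nth_equalityI) (auto simp: coords_def)
  have "coords bs ` {x. h x \<in> A} =
      {xs. length xs = DIM('a) \<and> map (\<lambda>k. xs ! i k) [0..<DIM('b)] \<in> coords cs ` A}"
    (is "_ = ?R")
  proof (intro equalityI subsetI)
    fix xs assume xs: "xs \<in> ?R"
    then obtain x where x: "coords bs x = xs"
      using coords_surj[OF bs] by blast
    with xs have "coords cs (h x) \<in> coords cs ` A"
      unfolding hi x by blast
    then obtain y where "y \<in> A" "coords cs (h x) = coords cs y"
      by blast
    then have "h x \<in> A"
      by (simp add: coords_inj[OF cs(1)])
    then show "xs \<in> coords bs ` {x. h x \<in> A}" using x by blast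
  next
    fix xs assume "xs \<in> coords bs ` {x. h x \<in> A}"
    then obtain x where x: "xs = coords bs x" "h x \<in> A" by blast
    then have "coords cs (h x) \<in> coords cs ` A" by blast
    then show "xs \<in> ?R"
      using length_basis_list[OF bs] unfolding hi x by (simp add: coords_def[of bs])
  qed
  then show ?thesis
    using S_select_coordinates[OF cs(2) i(1)] by simp
qed

text \<open>The identity is a coordinate map, hence definability does not depend on the enumeration
  and one enumeration can serve several sets at once.\<close>

lemma definable_coords:
  fixes A :: "'a::euclidean_space set"
  assumes "definable S A" "basis_list bs"
  shows "coords bs ` A \<in> S DIM('a)"
  using coords_vimage_coordinate_map[OF assms(1) coordinate_map_ident assms(2)] by simp

lemma definable_vimage_coordinate_map:
  assumes "definable S A" "coordinate_map h"
  shows "definable S {x. h x \<in> A}"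
  using coords_vimage_coordinate_map[OF assms] basis_list_exists unfolding definable_altdef by blast

text \<open>In a basis of the product that lists the vectors of the first factor first, the
  projection keeps an initial segment of each list.\<close>

lemma definable_fst_image:
  fixes A :: "('a::euclidean_space \<times> 'b::euclidean_space) set"
  assumes "definable S A"
  shows "definable S (fst ` A)"
proof -
  obtain bs :: "'a list" and cs :: "'b list" where bc: "basis_list bs" "basis_list cs"
    using basis_list_exists by metis
  let ?ds = "map (\<lambda>u. (u, 0 :: 'b)) bs @ map (\<lambda>v. (0 :: 'a, v)) cs"
  have "0 \<notin> set bs" "0 \<notin> set cs" using bc by (auto simp: basis_list_def)
  then have ds: "basis_list ?ds"
    using bc unfolding basis_list_def
    by (auto simp: distinct_map inj_on_def Basis_prod_def)
  have "coords ?ds z = coords bs (fst z) @ coords cs (snd z)" for z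
    by (cases z) (auto simp: coords_def)
  then have "take DIM('a) (coords ?ds z) = coords bs (fst z)" for z
    using length_basis_list[OF bc(1)] by (simp add: coords_def)
  then have "take DIM('a) ` coords ?ds ` A = coords bs ` fst ` A"
    unfolding image_image by simp
  then have "coords bs ` fst ` A \<in> S DIM('a)"
    using S_take[of "coords ?ds ` A" "DIM('a)" "DIM('b)"] definable_coords[OF assms ds] by simp
  then show ?thesis
    using bc(1) unfolding definable_altdef by blast
qed

lemma definable_Un:
  fixes A B :: "'a::euclidean_space set"
  assumes "definable S A" "definable S B"
  shows "definable S (A \<union> B)"
proof -
  obtain bs :: "'a list" where bs: "basis_list bs"
    using basis_list_exists by metis
  then have "coords bs ` (A \<union> B) \<in> S DIM('a)"
    unfolding image_Un by (intro union definable_coords assms)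
  then show ?thesis
    using bs unfolding definable_altdef by blast
qed

lemma definable_Compl:
  fixes A :: "'a::euclidean_space set"
  assumes "definable S A"
  shows "definable S (- A)"
proof -
  obtain bs :: "'a list" where bs: "basis_list bs"
    using basis_list_exists by metis
  have "coords bs ` (- A) = {xs. length xs = DIM('a)} - coords bs ` A"
    (is "_ = ?R")
  proof (intro equalityI subsetI)
    fix xs assume xs: "xs \<in> ?R"
    then obtain x where "coords bs x = xs"
      using coords_surj[OF bs] by blast
    then show "xs \<in> coords bs ` (- A)" using xs by auto
  next
    fix xs assume "xs \<in> coords bs ` (- A)"
    then show "xs \<in> ?R"
      using coords_inj[OF bs] length_basis_list[OF bs] by (auto simp: coords_def)
  qed
  then show ?thesis
    using complement[OF definable_coords[OF assms bs]] bs unfolding definable_altdef by metis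
qed

lemma definable_real_iff:
  "definable S A \<longleftrightarrow> (\<exists>\<I>. finite \<I> \<and> (\<forall>I\<in>\<I>. is_interval I) \<and> A = \<Union>\<I>)" for A :: "real set"
proof -
  have "basis_list bs \<longleftrightarrow> bs = [1]" for bs :: "real list"
    unfolding basis_list_def by (cases bs) (auto simp: insert_ident subset_singleton_iff)
  then have "definable S A \<longleftrightarrow> (\<lambda>x. [x]) ` A \<in> S 1"
    unfolding definable_altdef by (simp add: coords_def)
  then show ?thesis using o_minimal[of A] by simp
qed

lemma definable_addition: "definable S {(x :: real, y, z). z = x + y}"
proof -
  let ?bs = "[(1, 0, 0), (0, 1, 0), (0, 0, 1)] :: (real \<times> real \<times> real) list"
  have "basis_list ?bs" by (auto simp: basis_list_def Basis_prod_def zero_prod_def)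
  moreover have "coords ?bs ` {(x, y, z). z = x + y} = {[x, y, x + y] |x y. True}"
    by (force simp: coords_def)
  ultimately show ?thesis
    using addition unfolding definable_altdef
    by (intro exI[of _ ?bs]) (simp add: numeral_3_eq_3)
qed

lemma definable_multiplication: "definable S {(x :: real, y, z). z = x * y}"
proof -
  let ?bs = "[(1, 0, 0), (0, 1, 0), (0, 0, 1)] :: (real \<times> real \<times> real) list"
  have "basis_list ?bs" by (auto simp: basis_list_def Basis_prod_def zero_prod_def)
  moreover have "coords ?bs ` {(x, y, z). z = x * y} = {[x, y, x * y] |x y. True}"
    by (force simp: coords_def)
  ultimately show ?thesis
    using multiplication unfolding definable_altdef
    by (intro exI[of _ ?bs]) (simp add: numeral_3_eq_3)
qed

lemma definable_coordinates_eq: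
  fixes b c :: "'a::euclidean_space"
  assumes "b \<in> Basis" "c \<in> Basis"
  shows "definable S {x. x \<bullet> b = x \<bullet> c}"
proof -
  obtain bs :: "'a list" where bs: "basis_list bs"
    using basis_list_exists by metis
  obtain i j where ij: "i < DIM('a)" "bs ! i = b" "j < DIM('a)" "bs ! j = c"
    using bs assms length_basis_list[OF bs] unfolding basis_list_def by (metis in_set_conv_nth)
  have "coords bs ` {x. x \<bullet> b = x \<bullet> c} = {xs. length xs = DIM('a) \<and> xs ! i = xs ! j}"
    (is "_ = ?R")
  proof (intro equalityI subsetI)
    fix xs assume "xs \<in> ?R"
    moreover obtain x where "coords bs x = xs"
      using coords_surj[OF bs] \<open>xs \<in> ?R\<close> by blast
    ultimately show "xs \<in> coords bs ` {x. x \<bullet> b = x \<bullet> c}"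
      using ij length_basis_list[OF bs] by (auto simp: coords_def)
  qed (use ij length_basis_list[OF bs] in \<open>auto simp: coords_def\<close>)
  then show ?thesis
    using diagonal[OF ij(1,3)] bs unfolding definable_altdef by metis
qed

section \<open>First-order formulas as definable predicates and functions\<close>

abbreviation dpred :: "('a::euclidean_space \<Rightarrow> bool) \<Rightarrow> bool" where
  "dpred P \<equiv> definable S {x. P x}"

abbreviation dfun :: "('a::euclidean_space \<Rightarrow> 'b::euclidean_space) \<Rightarrow> bool" where
  "dfun f \<equiv> definable_fun S f"

lemma dpred_not:
  assumes "dpred P"
  shows "dpred (\<lambda>x. \<not> P x)"
  unfolding Collect_neg_eq by (rule definable_Compl[OF assms])

lemma dpred_disj:
  assumes "dpred P" "dpred Q"
  shows "dpred (\<lambda>x. P x \<or> Q x)"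
  unfolding Collect_disj_eq by (rule definable_Un[OF assms])

lemma dpred_conj:
  assumes "dpred P" "dpred Q"
  shows "dpred (\<lambda>x. P x \<and> Q x)"
  using dpred_not[OF dpred_disj[OF assms[THEN dpred_not]]] by simp

lemma dpred_imp:
  assumes "dpred P" "dpred Q"
  shows "dpred (\<lambda>x. P x \<longrightarrow> Q x)"
  unfolding imp_conv_disj by (rule dpred_disj[OF dpred_not[OF assms(1)] assms(2)])

text \<open>An existential quantifier is a projection; the bound variable becomes the second
  component of a pair. The quantifier rules together with the rules for connectives and terms let
  definability proofs follow the syntax of a formula.\<close>

lemma dpred_ex:
  assumes "dpred (\<lambda>z. P (fst z) (snd z))"
  shows "dpred (\<lambda>x. \<exists>y. P x y)"
proof -
  have "{x. \<exists>y. P x y} = fst ` {z. P (fst z) (snd z)}"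
    by (auto simp: image_iff Bex_def)
  then show ?thesis
    using definable_fst_image[OF assms] by simp
qed

lemma dpred_all:
  assumes "dpred (\<lambda>z. P (fst z) (snd z))"
  shows "dpred (\<lambda>x. \<forall>y. P x y)"
  using dpred_not[OF dpred_ex[OF dpred_not[OF assms]]] by simp

lemma dpred_coordinate_map:
  assumes "dpred P" "coordinate_map h"
  shows "dpred (\<lambda>x. P (h x))"
  using definable_vimage_coordinate_map[OF assms] by simp

lemma dpred_const: "dpred (\<lambda>x :: 'a::euclidean_space. c)"
proof -
  obtain b :: 'a where b: "b \<in> Basis" using nonempty_Basis by blast
  have "dpred (\<lambda>x :: 'a. True)"
    using definable_coordinates_eq[OF b b] by simp
  then show ?thesis
    using dpred_not[of "\<lambda>x :: 'a. True"] by (cases c) auto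
qed

lemma dpred_Ball_finite:
  assumes "finite I" "\<And>i. i \<in> I \<Longrightarrow> dpred (P i)"
  shows "dpred (\<lambda>x. \<forall>i\<in>I. P i x)"
  using assms
  by (induction I rule: finite_induct)
    (auto intro!: dpred_conj dpred_const[of True, simplified])

lemma dfun_iff: "dfun f \<longleftrightarrow> dpred (\<lambda>z. snd z = f (fst z))"
  unfolding definable_fun_def case_prod_unfold ..

text \<open>The graph is a finite intersection of diagonals, one for each basis vector of the
  target.\<close>

lemma dfun_coordinate_map:
  assumes "coordinate_map h"
  shows "dfun h"
proof -
  have "dpred (\<lambda>z. snd z \<bullet> b = h (fst z) \<bullet> b)" if b: "b \<in> Basis" for b
  proof -
    obtain c where c: "c \<in> Basis" "\<And>x. h x \<bullet> b = x \<bullet> c"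
      using assms b unfolding coordinate_map_def by metis
    have "(0, b) \<in> Basis" "(c, 0) \<in> Basis"
      using b c by (auto simp: Basis_prod_def)
    from definable_coordinates_eq[OF this] show ?thesis
      by (simp add: c inner_prod_def)
  qed
  then show ?thesis
    unfolding dfun_iff euclidean_eq_iff[where 'a = 'b]
    by (rule dpred_Ball_finite[OF finite_Basis])
qed

text \<open>Substitution is expressed with an auxiliary variable, as
  \<open>\<exists>y. y = h x \<and> P y\<close>, which needs only coordinate maps, a conjunction and
  a projection.\<close>

lemma dpred_compose:
  assumes "dpred P" "dfun h"
  shows "dpred (\<lambda>x. P (h x))"
proof -
  have "dpred (\<lambda>x. \<exists>y. y = h x \<and> P y)"
    using assms(2) unfolding dfun_iff
    by (intro dpred_ex dpred_conj dpred_coordinate_map[OF assms(1)] coordinate_map_intros)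
  then show ?thesis by simp
qed

lemma dfun_ident: "dfun (\<lambda>x. x)"
  by (intro dfun_coordinate_map coordinate_map_intros)

lemma dfun_compose:
  assumes g: "dfun g" and f: "dfun f"
  shows "dfun (\<lambda>x. g (f x))"
proof -
  note f' = f[unfolded dfun_iff, THEN dpred_coordinate_map, of "\<lambda>z. (fst (fst z), snd z)"]
  note g' = g[unfolded dfun_iff, THEN dpred_coordinate_map, of "\<lambda>z. (snd z, snd (fst z))"]
  have "dpred (\<lambda>x. \<exists>y. y = f (fst x) \<and> snd x = g y)"
    using f' g' by (intro dpred_ex dpred_conj) (simp_all add: coordinate_map_intros)
  then show ?thesis unfolding dfun_iff by simp
qed

lemma dfun_fst: "dfun f \<Longrightarrow> dfun (\<lambda>x. fst (f x))"
  by (rule dfun_compose[OF dfun_coordinate_map[OF coordinate_map_fst[OF coordinate_map_ident]]])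

lemma dfun_snd: "dfun f \<Longrightarrow> dfun (\<lambda>x. snd (f x))"
  by (rule dfun_compose[OF dfun_coordinate_map[OF coordinate_map_snd[OF coordinate_map_ident]]])

lemma dfun_Pair:
  assumes f: "dfun f" and g: "dfun g"
  shows "dfun (\<lambda>x. (f x, g x))"
proof -
  note f' = f[unfolded dfun_iff, THEN dpred_coordinate_map, of "\<lambda>z. (fst z, fst (snd z))"]
  note g' = g[unfolded dfun_iff, THEN dpred_coordinate_map, of "\<lambda>z. (fst z, snd (snd z))"]
  have "dpred (\<lambda>z. fst (snd z) = f (fst z) \<and> snd (snd z) = g (fst z))"
    using f' g' by (intro dpred_conj) (simp_all add: coordinate_map_intros)
  then show ?thesis unfolding dfun_iff by (simp add: prod_eq_iff)
qed

lemma dpred_compose2: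
  assumes "dpred (\<lambda>z. P (fst z) (snd z))" "dfun f" "dfun g"
  shows "dpred (\<lambda>x. P (f x) (g x))"
  using dpred_compose[OF assms(1) dfun_Pair[OF assms(2,3)]] by simp

lemma dfun_compose2:
  assumes "dfun (\<lambda>z. h (fst z) (snd z))" "dfun f" "dfun g"
  shows "dfun (\<lambda>x. h (f x) (g x))"
  using dfun_compose[OF assms(1) dfun_Pair[OF assms(2,3)]] by simp

lemma dpred_eq:
  assumes "dfun f" "dfun g"
  shows "dpred (\<lambda>x. f x = g x)"
  by (rule dpred_compose2[OF _ assms])
    (use dfun_ident[unfolded dfun_iff] in \<open>simp add: eq_commute\<close>)

lemma dpred_ge_0: "dpred (\<lambda>x :: real. 0 \<le> x)"
  unfolding definable_real_iff
  by (rule exI[of _ "{{0..}}"]) (auto simp: is_interval_ci)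

lemma dfun_const_real: "dfun (\<lambda>x :: 'a::euclidean_space. c :: real)"
proof -
  have "dpred (\<lambda>x :: real. x = c)"
    unfolding definable_real_iff by (rule exI[of _ "{{c..c}}"]) (auto simp del: atLeastAtMost_singleton simp: is_interval_cc)
  then show ?thesis
    unfolding dfun_iff by (rule dpred_coordinate_map) (intro coordinate_map_intros)
qed

lemma dfun_add_real:
  fixes f g :: "'a::euclidean_space \<Rightarrow> real"
  assumes "dfun f" "dfun g"
  shows "dfun (\<lambda>x. f x + g x)"
proof (rule dfun_compose2[OF _ assms])
  have "coordinate_map (\<lambda>z :: (real \<times> real) \<times> real. (fst (fst z), snd (fst z), snd z))"
    by (intro coordinate_map_intros)
  from definable_vimage_coordinate_map[OF definable_addition this]
  show "dfun (\<lambda>z. fst z + snd z :: real)"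
    unfolding dfun_iff by (simp add: case_prod_beta)
qed

lemma dfun_mult:
  fixes f g :: "'a::euclidean_space \<Rightarrow> real"
  assumes "dfun f" "dfun g"
  shows "dfun (\<lambda>x. f x * g x)"
proof (rule dfun_compose2[OF _ assms])
  have "coordinate_map (\<lambda>z :: (real \<times> real) \<times> real. (fst (fst z), snd (fst z), snd z))"
    by (intro coordinate_map_intros)
  from definable_vimage_coordinate_map[OF definable_multiplication this]
  show "dfun (\<lambda>z. fst z * snd z :: real)"
    unfolding dfun_iff by (simp add: case_prod_beta)
qed

lemma dfun_uminus:
  fixes f :: "'a::euclidean_space \<Rightarrow> real"
  assumes "dfun f"
  shows "dfun (\<lambda>x. - f x)"
  using dfun_mult[OF dfun_const_real[of "-1"] assms] by simp

lemma dfun_diff: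
  fixes f g :: "'a::euclidean_space \<Rightarrow> real"
  assumes "dfun f" "dfun g"
  shows "dfun (\<lambda>x. f x - g x)"
  using dfun_add_real[OF assms(1) dfun_uminus[OF assms(2)]] by simp

lemma dpred_le:
  fixes f g :: "'a::euclidean_space \<Rightarrow> real"
  assumes "dfun f" "dfun g"
  shows "dpred (\<lambda>x. f x \<le> g x)"
  using dpred_compose[OF dpred_ge_0 dfun_diff[OF assms(2,1)]] by simp

lemma dpred_less:
  fixes f g :: "'a::euclidean_space \<Rightarrow> real"
  assumes "dfun f" "dfun g"
  shows "dpred (\<lambda>x. f x < g x)"
  using dpred_not[OF dpred_le[OF assms(2,1)]] by (simp add: not_le)

lemma dfun_If:
  assumes "dpred P" "dfun f" "dfun g"
  shows "dfun (\<lambda>x. if P x then f x else g x)"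
proof -
  have "dpred (\<lambda>z. P (fst z) \<and> snd z = f (fst z) \<or> \<not> P (fst z) \<and> snd z = g (fst z))"
    using assms(2,3)[unfolded dfun_iff]
    by (intro dpred_disj dpred_conj dpred_not dpred_compose[OF assms(1)] dfun_fst dfun_ident)
  then show ?thesis
    unfolding dfun_iff by (rule arg_cong[where f = "definable S", THEN iffD1, rotated]) auto
qed

lemma dfun_divide:
  fixes f g :: "'a::euclidean_space \<Rightarrow> real"
  assumes "dfun f" "dfun g"
  shows "dfun (\<lambda>x. f x / g x)"
proof (rule dfun_compose2[OF _ assms])
  \<comment> \<open>The second disjunct encodes the convention that division by 0 yields 0.\<close>
  have "dpred (\<lambda>z :: (real \<times> real) \<times> real.
      snd (fst z) \<noteq> 0 \<and> snd z * snd (fst z) = fst (fst z) \<or> snd (fst z) = 0 \<and> snd z = 0)"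
    by (intro dpred_disj dpred_conj dpred_not dpred_eq dfun_const_real dfun_mult
        dfun_fst dfun_snd dfun_ident)
  then show "dfun (\<lambda>z. fst z / snd z :: real)"
    unfolding dfun_iff
    by (rule arg_cong[where f = "definable S", THEN iffD1, rotated]) (auto simp: field_simps)
qed

lemma dfun_power:
  fixes f :: "'a::euclidean_space \<Rightarrow> real"
  assumes "dfun f"
  shows "dfun (\<lambda>x. f x ^ n)"
proof (induction n)
  case 0
  show ?case using dfun_const_real by simp
next
  case (Suc n)
  show ?case using dfun_mult[OF assms Suc] by simp
qed

lemma dfun_abs:
  fixes f :: "'a::euclidean_space \<Rightarrow> real"
  assumes "dfun f"
  shows "dfun (\<lambda>x. \<bar>f x\<bar>)"
  unfolding abs_if by (intro dfun_If dpred_less dfun_uminus dfun_const_real assms)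

lemma dfun_sum:
  fixes f :: "'i \<Rightarrow> 'a::euclidean_space \<Rightarrow> real"
  assumes "\<And>i. i \<in> I \<Longrightarrow> dfun (f i)"
  shows "dfun (\<lambda>x. \<Sum>i\<in>I. f i x)"
  using assms
  by (induction I rule: infinite_finite_induct) (simp_all add: dfun_const_real dfun_add_real)

lemma dfun_inner_Basis:
  assumes "dfun f" "b \<in> Basis"
  shows "dfun (\<lambda>x. f x \<bullet> b)"
  by (rule dfun_compose[OF dfun_coordinate_map[OF coordinate_map_inner[OF coordinate_map_ident]]])
    (fact assms)+

lemma dfun_const: "dfun (\<lambda>x :: 'a::euclidean_space. c :: 'b::euclidean_space)"
proof -
  have "dpred (\<lambda>z :: 'a \<times> 'b. \<forall>b\<in>Basis. snd z \<bullet> b = c \<bullet> b)"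
    by (intro dpred_Ball_finite finite_Basis dpred_eq dfun_const_real dfun_inner_Basis
        dfun_snd dfun_ident)
  then show ?thesis
    unfolding dfun_iff euclidean_eq_iff[where 'a = 'b] .
qed

text \<open>The distance is the nonnegative root of a sum of squares, so the square root enters only
  through a polynomial equation and a sign condition.\<close>

lemma dfun_dist:
  fixes f g :: "'a::euclidean_space \<Rightarrow> 'b::euclidean_space"
  assumes "dfun f" "dfun g"
  shows "dfun (\<lambda>x. dist (f x) (g x))"
proof (rule dfun_compose2[OF _ assms])
  have "dpred (\<lambda>z :: ('b \<times> 'b) \<times> real.
      0 \<le> snd z \<and> snd z ^ 2 = (\<Sum>b\<in>Basis. (fst (fst z) \<bullet> b - snd (fst z) \<bullet> b)\<^sup>2))"
    by (intro dpred_conj dpred_le dpred_eq dfun_power dfun_sum dfun_diff dfun_inner_Basis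
        dfun_const_real dfun_fst dfun_snd dfun_ident)
  moreover have "0 \<le> t \<and> t ^ 2 = (\<Sum>b\<in>Basis. (x \<bullet> b - y \<bullet> b)\<^sup>2) \<longleftrightarrow> t = dist x y"
    for t and x y :: 'b
  proof -
    let ?s = "\<Sum>b\<in>Basis. (x \<bullet> b - y \<bullet> b)\<^sup>2"
    have "dist x y = sqrt ?s"
      unfolding euclidean_dist_l2[of x y] L2_set_def dist_real_def by simp
    moreover have "0 \<le> ?s" by (simp add: sum_nonneg)
    ultimately show ?thesis
      using real_sqrt_unique[of t ?s] by auto
  qed
  ultimately show "dfun (\<lambda>z :: 'b \<times> 'b. dist (fst z) (snd z))"
    unfolding dfun_iff by simp
qed

lemmas dpred_intros = dpred_const dpred_not dpred_conj dpred_disj dpred_imp dpred_ex dpred_all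
  dpred_eq dpred_le dpred_less
lemmas dfun_intros = dfun_const dfun_ident dfun_fst dfun_snd dfun_Pair dfun_add_real dfun_diff
  dfun_uminus dfun_mult dfun_divide dfun_power dfun_abs dfun_If dfun_dist
lemmas definable_intros = dpred_intros dfun_intros

text \<open>Being the greatest lower bound is a first-order condition. The assumptions
  \<open>ne\<close> and \<open>bdd\<close> ensure that \<open>Inf\<close> really is the greatest
  lower bound.\<close>

lemma dfun_Inf:
  assumes Q: "dpred (\<lambda>z. Q (fst z) (snd z))"
    and ne: "\<And>x. \<exists>r. Q x r" and bdd: "\<And>x. bdd_below {r. Q x r}"
  shows "dfun (\<lambda>x :: 'a::euclidean_space. Inf {r :: real. Q x r})"
proof -
  have "dpred (\<lambda>z. (\<forall>r. Q (fst z) r \<longrightarrow> snd z \<le> r) \<and>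
      (\<forall>s. (\<forall>r. Q (fst z) r \<longrightarrow> s \<le> r) \<longrightarrow> s \<le> snd z))"
    by (intro definable_intros dpred_compose2[OF Q])
  moreover have "(\<forall>r. Q x r \<longrightarrow> t \<le> r) \<and> (\<forall>s. (\<forall>r. Q x r \<longrightarrow> s \<le> r) \<longrightarrow> s \<le> t) \<longleftrightarrow>
      t = Inf {r. Q x r}" for x t
  proof
    assume "(\<forall>r. Q x r \<longrightarrow> t \<le> r) \<and> (\<forall>s. (\<forall>r. Q x r \<longrightarrow> s \<le> r) \<longrightarrow> s \<le> t)"
    then have "t \<le> Inf {r. Q x r}" "Inf {r. Q x r} \<le> t"
      using ne[of x] bdd[of x] by (auto intro!: cInf_greatest dest: cInf_lower[OF _ bdd[of x], OF CollectI])
    then show "t = Inf {r. Q x r}" by simp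
  next
    assume t: "t = Inf {r. Q x r}"
    show "(\<forall>r. Q x r \<longrightarrow> t \<le> r) \<and> (\<forall>s. (\<forall>r. Q x r \<longrightarrow> s \<le> r) \<longrightarrow> s \<le> t)"
      using ne[of x] bdd[of x] unfolding t by (auto intro: cInf_lower cInf_greatest)
  qed
  ultimately show ?thesis
    unfolding dfun_iff by simp
qed

text \<open>The epsilon-delta condition on the difference quotient is a first-order formula in the
  point and the slope.\<close>

lemma dpred_has_real_derivative:
  fixes f :: "real \<Rightarrow> real"
  assumes f: "dfun f"
  shows "dpred (\<lambda>z. (f has_real_derivative snd z) (at (fst z)))"
proof -
  have "(f has_real_derivative D) (at x) \<longleftrightarrow>
      (\<forall>e. 0 < e \<longrightarrow> (\<exists>d. 0 < d \<and> (\<forall>y. \<not> y = x \<and> \<bar>y - x\<bar> < d \<longrightarrow>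
        \<bar>(f y - f x) / (y - x) - D\<bar> < e)))" for D x
    unfolding has_field_derivative_iff Lim_at dist_real_def by auto
  then show ?thesis
    by (simp only:) (intro definable_intros dfun_compose[OF f])
qed

lemma dfun_deriv:
  fixes f :: "real \<Rightarrow> real"
  assumes f: "dfun f"
  shows "dfun (deriv f)"
proof -
  \<comment> \<open>The junk value of \<open>deriv\<close> at a point where the function is not differentiable.\<close>
  define c where "c = (SOME D :: real. False)"
  have "dpred (\<lambda>z. (f has_real_derivative snd z) (at (fst z)) \<or>
      \<not> (\<exists>D. (f has_real_derivative D) (at (fst z))) \<and> snd z = c)"
    by (intro definable_intros dpred_compose2[OF dpred_has_real_derivative[OF f]])
  moreover have "(f has_real_derivative D) (at x) \<or>
      \<not> (\<exists>D. (f has_real_derivative D) (at x)) \<and> D = c \<longleftrightarrow> D = deriv f x" for D x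
  proof (cases "\<exists>D. (f has_real_derivative D) (at x)")
    case True
    then show ?thesis
      using DERIV_deriv_iff_real_differentiable DERIV_imp_deriv DERIV_unique by metis
  next
    case False
    then have "deriv f x = c"
      unfolding deriv_def c_def by simp
    then show ?thesis using False by auto
  qed
  ultimately show ?thesis
    unfolding dfun_iff by simp
qed

end

section \<open>Germs of definable functions at the origin\<close>

lemma interval_eventually_at_right:
  fixes I :: "real set"
  assumes "is_interval I"
  shows "eventually (\<lambda>y. y \<in> I) (at_right x) \<or> eventually (\<lambda>y. y \<notin> I) (at_right x)"
proof (cases "\<exists>y\<in>I. x < y \<and> (\<exists>d>x. \<forall>z. x < z \<and> z < d \<longrightarrow> z \<notin> I)")
  case True
  then show ?thesis unfolding eventually_at_right_field by blast
next
  case no: False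
  show ?thesis
  proof (cases "\<exists>y\<in>I. x < y")
    case True
    then obtain y where y: "y \<in> I" "x < y" by blast
    have "z \<in> I" if z: "x < z" "z < y" for z
    proof -
      \<comment> \<open>No gap of \<open>I\<close> adjoins \<open>x\<close> on the right, so
        \<open>I\<close> has a point between \<open>x\<close> and \<open>z\<close>; convexity with
        \<open>y\<close> then captures \<open>z\<close>.\<close>
      obtain w where "x < w" "w < z" "w \<in> I"
        using no y z by blast
      then show ?thesis
        using assms y(1) z(2) unfolding is_interval_1 by (meson less_imp_le)
    qed
    then show ?thesis
      using y(2) unfolding eventually_at_right_field by blast
  next
    case False
    then show ?thesis
      unfolding eventually_at_right_field by (meson gt_ex)
  qed
qed

text \<open>If the lower and upper limits differed, then for a real \<open>q\<close> strictly
  between them \<open>q < g y\<close> could neither hold eventually nor fail eventually.\<close>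

lemma tendsto_ereal_of_dichotomy:
  fixes g :: "'a \<Rightarrow> real"
  assumes F: "F \<noteq> bot"
    and dich: "\<And>q. eventually (\<lambda>y. q < g y) F \<or> eventually (\<lambda>y. \<not> q < g y) F"
  shows "\<exists>L. ((\<lambda>y. ereal (g y)) \<longlongrightarrow> L) F"
proof (rule ccontr)
  assume "\<not> ?thesis"
  then have "Liminf F (\<lambda>y. ereal (g y)) \<noteq> Limsup F (\<lambda>y. ereal (g y))"
    using tendsto_iff_Liminf_eq_Limsup[OF F] by blast
  then have "Liminf F (\<lambda>y. ereal (g y)) < Limsup F (\<lambda>y. ereal (g y))"
    using Liminf_le_Limsup[OF F, of "\<lambda>y. ereal (g y)"] by simp
  then obtain q where q: "Liminf F (\<lambda>y. ereal (g y)) < ereal q"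
    "ereal q < Limsup F (\<lambda>y. ereal (g y))"
    using ereal_dense2 by blast
  from dich[of q] show False
  proof
    assume "eventually (\<lambda>y. q < g y) F"
    then have "ereal q \<le> Liminf F (\<lambda>y. ereal (g y))"
      by (intro Liminf_bounded) (auto elim!: eventually_mono)
    then show False using q by simp
  next
    assume "eventually (\<lambda>y. \<not> q < g y) F"
    then have "Limsup F (\<lambda>y. ereal (g y)) \<le> ereal q"
      by (intro Limsup_bounded) (auto elim!: eventually_mono)
    then show False using q by simp
  qed
qed

text \<open>Each such point is the unique minimizer of \<open>f\<close> on an interval with rational
  endpoints, so the choice \<open>J\<close> of one such interval is injective.\<close>

lemma countable_strict_local_minima:
  fixes f :: "real \<Rightarrow> real"
  shows "countable {x. eventually (\<lambda>y. f x < f y) (at x)}"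
proof -
  let ?M = "{x. eventually (\<lambda>y. f x < f y) (at x)}"
  define J where "J x = (SOME (p, q). p \<in> \<rat> \<and> q \<in> \<rat> \<and> p < x \<and> x < q \<and>
    (\<forall>y. p < y \<and> y < q \<and> y \<noteq> x \<longrightarrow> f x < f y))" for x
  have J: "fst (J x) \<in> \<rat>" "snd (J x) \<in> \<rat>" "fst (J x) < x" "x < snd (J x)"
    "\<And>y. fst (J x) < y \<Longrightarrow> y < snd (J x) \<Longrightarrow> y \<noteq> x \<Longrightarrow> f x < f y" if x: "x \<in> ?M" for x
  proof -
    obtain d where d: "d > 0" "\<And>y. y \<noteq> x \<Longrightarrow> dist y x < d \<Longrightarrow> f x < f y"
      using x unfolding eventually_at by auto
    obtain p q where "p \<in> \<rat>" "x - d < p" "p < x" "q \<in> \<rat>" "x < q" "q < x + d"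
      using Rats_dense_in_real[of "x - d" x] Rats_dense_in_real[of x "x + d"] d(1) by auto
    then have "\<exists>pq. case pq of (p, q) \<Rightarrow> p \<in> \<rat> \<and> q \<in> \<rat> \<and> p < x \<and> x < q \<and>
        (\<forall>y. p < y \<and> y < q \<and> y \<noteq> x \<longrightarrow> f x < f y)"
      using d(2) by (intro exI[of _ "(p, q)"]) (auto simp: dist_real_def)
    from someI_ex[OF this, folded J_def] show "fst (J x) \<in> \<rat>" "snd (J x) \<in> \<rat>"
      "fst (J x) < x" "x < snd (J x)"
      "\<And>y. fst (J x) < y \<Longrightarrow> y < snd (J x) \<Longrightarrow> y \<noteq> x \<Longrightarrow> f x < f y"
      by (auto simp: case_prod_beta)
  qed
  have "inj_on J ?M"
  proof (rule inj_onI, rule ccontr)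
    fix x y assume xy: "x \<in> ?M" "y \<in> ?M" "J x = J y" "x \<noteq> y"
    then have "f x < f y" "f y < f x"
      using J(3,4,5)[OF xy(1)] J(3,4,5)[OF xy(2)] by auto
    then show False by simp
  qed
  moreover have "J ` ?M \<subseteq> \<rat> \<times> \<rat>"
    by (rule image_subsetI, unfold mem_Times_iff, blast intro: J(1,2))
  moreover have "countable (\<rat> \<times> \<rat> :: (real \<times> real) set)"
    by (intro countable_SIGMA countable_rat)
  ultimately show ?thesis
    using countable_image_inj_on countable_subset by blast
qed

text \<open>A rational \<open>q\<close> separates the two slopes, and subtracting the line of slope
  \<open>q\<close> turns \<open>x\<close> into a strict local minimum; on the left the negative sign
  of \<open>y - x\<close> reverses the inequality. Countably many \<open>q\<close> suffice.\<close>

lemma countable_left_limit_less_right_limit: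
  fixes f :: "real \<Rightarrow> real" and l r :: "real \<Rightarrow> ereal"
  assumes l: "\<And>x. ((\<lambda>y. ereal ((f y - f x) / (y - x))) \<longlongrightarrow> l x) (at_left x)"
    and r: "\<And>x. ((\<lambda>y. ereal ((f y - f x) / (y - x))) \<longlongrightarrow> r x) (at_right x)"
  shows "countable {x. l x < r x}"
proof (rule countable_subset)
  show "countable (\<Union>q\<in>\<rat>. {x. eventually (\<lambda>y. f x - q * x < f y - q * y) (at x)})"
    by (intro countable_UN countable_rat countable_strict_local_minima)
  show "{x. l x < r x} \<subseteq> (\<Union>q\<in>\<rat>. {x. eventually (\<lambda>y. f x - q * x < f y - q * y) (at x)})"
  proof
    fix x assume "x \<in> {x. l x < r x}"
    then obtain u v where uv: "l x < ereal u" "ereal u < ereal v" "ereal v < r x"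
      using ereal_dense2 by (metis mem_Collect_eq)
    obtain q where q: "q \<in> \<rat>" "u < q" "q < v"
      using Rats_dense_in_real[of u v] uv(2) by auto
    have "l x < ereal q" "ereal q < r x"
      using uv q less_trans[of "l x" "ereal u" "ereal q"] less_trans[of "ereal q" "ereal v" "r x"]
      by auto
    then have "eventually (\<lambda>y. (f y - f x) / (y - x) < q) (at_left x)"
      and "eventually (\<lambda>y. q < (f y - f x) / (y - x)) (at_right x)"
      using order_tendstoD(2)[OF l[of x], of "ereal q"] order_tendstoD(1)[OF r[of x], of "ereal q"]
      by simp_all
    moreover have "eventually (\<lambda>y. y < x) (at_left x)" "eventually (\<lambda>y. x < y) (at_right x)"
      by (auto simp: eventually_at_filter)
    ultimately have "eventually (\<lambda>y. y < x \<and> (f y - f x) / (y - x) < q) (at_left x)"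
      and "eventually (\<lambda>y. x < y \<and> q < (f y - f x) / (y - x)) (at_right x)"
      by (simp_all add: eventually_conj_iff)
    then have "eventually (\<lambda>y. f x - q * x < f y - q * y) (at_left x)"
      and "eventually (\<lambda>y. f x - q * x < f y - q * y) (at_right x)"
      by (auto elim!: eventually_mono simp: field_simps)
    then show "x \<in> (\<Union>q\<in>\<rat>. {x. eventually (\<lambda>y. f x - q * x < f y - q * y) (at x)})"
      using q(1) unfolding eventually_at_split by blast
  qed
qed

text \<open>The supremum of the points of \<open>[a, b]\<close> with value at least
  \<open>f a\<close> is itself such a point, by the slopes to its left, and it cannot lie below
  \<open>b\<close>, by the slopes to its right.\<close>

lemma locally_increasing_imp_mono:
  fixes f :: "real \<Rightarrow> real"
  assumes ab: "a \<le> b"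
    and inc: "\<And>x. a \<le> x \<Longrightarrow> x \<le> b \<Longrightarrow> eventually (\<lambda>y. 0 \<le> (f y - f x) / (y - x)) (at x)"
  shows "f a \<le> f b"
proof -
  define A where "A = {x. a \<le> x \<and> x \<le> b \<and> f a \<le> f x}"
  have A: "a \<in> A" "bdd_above A" using ab unfolding A_def by auto
  define s where "s = Sup A"
  have s: "a \<le> s" "s \<le> b"
    using A unfolding s_def by (auto simp: A_def intro: cSup_upper cSup_least)
  obtain d where d: "d > 0" "\<And>y. y \<noteq> s \<Longrightarrow> dist y s < d \<Longrightarrow> 0 \<le> (f y - f s) / (y - s)"
    using inc[OF s] unfolding eventually_at by auto
  obtain x where x: "x \<in> A" "s - d < x"
    using less_cSup_iff[of A "s - d"] A d(1) unfolding s_def by auto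
  then have "x \<le> s" using A(2) unfolding s_def by (simp add: cSup_upper)
  have "f x \<le> f s"
  proof (cases "x = s")
    case False
    then have "0 \<le> (f x - f s) / (x - s)" "x - s < 0"
      using d(2)[of x] x(2) \<open>x \<le> s\<close> by (auto simp: dist_real_def)
    then show ?thesis by (simp add: zero_le_divide_iff)
  qed simp
  then have fs: "f a \<le> f s" using x(1) unfolding A_def by simp
  have "s = b"
  proof (rule ccontr)
    assume "s \<noteq> b"
    define y where "y = min b (s + d / 2)"
    have y: "s < y" "y \<le> b" "dist y s < d"
      using s \<open>s \<noteq> b\<close> d(1) unfolding y_def dist_real_def by auto
    then have "f s \<le> f y"
      using d(2)[of y] by (auto simp: zero_le_divide_iff)
    then have "y \<in> A" using y fs s(1) unfolding A_def by auto
    then have "y \<le> s" using A(2) unfolding s_def by (simp add: cSup_upper)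
    then show False using y by simp
  qed
  then show ?thesis using fs by simp
qed

text \<open>Subtract a line whose slope \<open>q\<close> exceeds that of the chord by 1. The local
  slopes stay nonnegative, so the difference cannot decrease from \<open>a\<close> to
  \<open>b\<close>, yet its increment is \<open>a - b\<close>.\<close>

lemma not_infinite_slope_on_interval:
  fixes f :: "real \<Rightarrow> real"
  assumes "a < b"
    and inf: "\<And>x q. a \<le> x \<Longrightarrow> x \<le> b \<Longrightarrow> eventually (\<lambda>y. q < (f y - f x) / (y - x)) (at x)"
  shows False
proof -
  define q where "q = (f b - f a) / (b - a) + 1"
  have "f a - q * a \<le> f b - q * b"
  proof (rule locally_increasing_imp_mono[where f = "\<lambda>x. f x - q * x"])
    fix x assume "a \<le> x" "x \<le> b"
    from inf[OF this, of q]
    show "eventually (\<lambda>y. 0 \<le> (f y - q * y - (f x - q * x)) / (y - x)) (at x)"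
      using eventually_neq_at_within[of x x UNIV]
    proof eventually_elim
      case (elim y)
      then have "(f y - q * y - (f x - q * x)) / (y - x) = (f y - f x) / (y - x) - q"
        by (simp add: field_simps)
      then show ?case using elim by simp
    qed
  qed (use assms(1) in simp)
  moreover have "q * (b - a) = f b - f a + (b - a)"
    using assms(1) unfolding q_def by (simp add: field_simps)
  ultimately show False
    using assms(1) by (simp add: algebra_simps)
qed

section \<open>Consequences of o-minimality near a point\<close>

context o_minimal_structure
begin

text \<open>The alternative holds for a single interval and survives finite unions.\<close>

lemma dpred_dichotomy_at_right:
  fixes P :: "real \<Rightarrow> bool"
  assumes "dpred P"
  shows "eventually P (at_right x) \<or> eventually (\<lambda>y. \<not> P y) (at_right x)"
proof -
  obtain \<I> where \<I>: "finite \<I>" "\<forall>I\<in>\<I>. is_interval I" and P: "{x. P x} = \<Union>\<I>"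
    using assms unfolding definable_real_iff by blast
  from \<I> have "eventually (\<lambda>y. y \<in> \<Union>\<I>) (at_right x) \<or> eventually (\<lambda>y. y \<notin> \<Union>\<I>) (at_right x)"
  proof (induction \<I> rule: finite_induct)
    case (insert I \<I>)
    then consider "eventually (\<lambda>y. y \<in> I) (at_right x)" | "eventually (\<lambda>y. y \<in> \<Union>\<I>) (at_right x)"
      | "eventually (\<lambda>y. y \<notin> I) (at_right x)" "eventually (\<lambda>y. y \<notin> \<Union>\<I>) (at_right x)"
      using interval_eventually_at_right[of I x] by auto
    then show ?case
    proof cases
      case 3
      then have "eventually (\<lambda>y. y \<notin> \<Union>(insert I \<I>)) (at_right x)"
        by eventually_elim simp
      then show ?thesis by blast
    qed (auto elim: eventually_mono)
  qed simp
  moreover have "P = (\<lambda>y. y \<in> \<Union>\<I>)"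
    by (rule ext) (use P in blast)
  ultimately show ?thesis by (simp only:)
qed

lemma dpred_dichotomy_at_left:
  fixes P :: "real \<Rightarrow> bool"
  assumes "dpred P"
  shows "eventually P (at_left x) \<or> eventually (\<lambda>y. \<not> P y) (at_left x)"
  using dpred_dichotomy_at_right[OF dpred_compose[OF assms dfun_uminus[OF dfun_ident]], of "- x"]
  unfolding at_left_minus[of x] eventually_filtermap by simp

text \<open>By the dichotomy, the only alternative is that \<open>P\<close> fails on a whole
  interval, which is uncountable. Thus countable exceptional sets disappear near 0.\<close>

lemma dpred_eventually_at_right_0:
  fixes P :: "real \<Rightarrow> bool"
  assumes "dpred P" and "countable {x. x \<in> {0<..<d} \<and> \<not> P x}" "0 < d"
  shows "eventually P (at_right 0)"
proof (rule ccontr)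
  assume "\<not> ?thesis"
  then have "eventually (\<lambda>y. \<not> P y) (at_right 0)"
    using dpred_dichotomy_at_right[OF assms(1)] by blast
  then obtain e where e: "e > 0" "\<And>y. 0 < y \<Longrightarrow> y < e \<Longrightarrow> \<not> P y"
    unfolding eventually_at_right_field by auto
  have "{0<..<min d e} \<subseteq> {x. x \<in> {0<..<d} \<and> \<not> P x}"
    using e by auto
  then have "countable {0<..<min d e}"
    using assms(2) countable_subset by blast
  then show False
    using uncountable_open_interval[of 0 "min d e"] e(1) assms(3) by simp
qed

lemma dfun_slope:
  fixes f :: "real \<Rightarrow> real"
  assumes "dfun f"
  shows "dfun (\<lambda>z. (f (fst z) - f (snd z)) / (fst z - snd z))"
  by (intro definable_intros dfun_compose[OF assms])

lemma slope_tendsto_ereal: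
  fixes f :: "real \<Rightarrow> real"
  assumes f: "dfun f"
  shows "\<exists>L. ((\<lambda>y. ereal ((f y - f x) / (y - x))) \<longlongrightarrow> L) (at_right x)"
    and "\<exists>L. ((\<lambda>y. ereal ((f y - f x) / (y - x))) \<longlongrightarrow> L) (at_left x)"
proof -
  have "dpred (\<lambda>y. q < (f y - f x) / (y - x))" for q
    by (intro definable_intros dfun_compose2[OF dfun_slope[OF f]])
  from dpred_dichotomy_at_right[OF this] dpred_dichotomy_at_left[OF this]
  show "\<exists>L. ((\<lambda>y. ereal ((f y - f x) / (y - x))) \<longlongrightarrow> L) (at_right x)"
    "\<exists>L. ((\<lambda>y. ereal ((f y - f x) / (y - x))) \<longlongrightarrow> L) (at_left x)"
    by (intro tendsto_ereal_of_dichotomy; simp)+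
qed

lemma dpred_infinite_slope:
  fixes f :: "real \<Rightarrow> real"
  assumes f: "dfun f"
  shows "dpred (\<lambda>x. \<forall>q. eventually (\<lambda>y. q < (f y - f x) / (y - x)) (at x))"
proof -
  have "dpred (\<lambda>x. \<forall>q. \<exists>d. 0 < d \<and> (\<forall>y. y \<noteq> x \<and> \<bar>y - x\<bar> < d \<longrightarrow> q < (f y - f x) / (y - x)))"
    by (intro definable_intros dfun_compose2[OF dfun_slope[OF f]])
  then show ?thesis
    unfolding eventually_at dist_real_def by simp
qed

lemma not_eventually_infinite_slope:
  fixes f :: "real \<Rightarrow> real"
  shows "\<not> eventually (\<lambda>x. \<forall>q. eventually (\<lambda>y. q < (f y - f x) / (y - x)) (at x)) (at_right 0)"
proof
  assume "eventually (\<lambda>x. \<forall>q. eventually (\<lambda>y. q < (f y - f x) / (y - x)) (at x)) (at_right 0)"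
  then obtain d where "d > 0"
    and d: "\<And>x q. 0 < x \<Longrightarrow> x < d \<Longrightarrow> eventually (\<lambda>y. q < (f y - f x) / (y - x)) (at x)"
    unfolding eventually_at_right_field by auto
  then show False
    by (intro not_infinite_slope_on_interval[of "d / 3" "d / 2" f] d) auto
qed

text \<open>By the dichotomy it suffices to refute that \<open>f\<close> is differentiable nowhere
  on some \<open>(0, d)\<close>. Outside a countable set the one-sided slopes agree, and a finite
  common value would be a derivative. Hence near 0 every point has slope plus or minus infinity,
  while each of the two signs is excluded near 0.\<close>

lemma eventually_differentiable:
  fixes f :: "real \<Rightarrow> real"
  assumes f: "dfun f"
  shows "eventually (\<lambda>x. f field_differentiable (at x)) (at_right 0)"
proof (rule ccontr)
  let ?s = "\<lambda>f x y. (f y - f x) / (y - x) :: real"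
  let ?inf = "\<lambda>f x. \<forall>q. eventually (\<lambda>y. q < ?s f x y) (at x)"
  have f': "dfun (\<lambda>x. - f x)" by (intro dfun_uminus f)
  have "dpred (\<lambda>x. f field_differentiable (at x))"
    unfolding field_differentiable_def by (intro dpred_ex dpred_has_real_derivative f)
  moreover assume "\<not> ?thesis"
  ultimately have "eventually (\<lambda>x. \<not> f field_differentiable (at x)) (at_right 0)"
    using dpred_dichotomy_at_right by blast
  then obtain d where d: "d > 0" "\<And>x. 0 < x \<Longrightarrow> x < d \<Longrightarrow> \<not> f field_differentiable (at x)"
    unfolding eventually_at_right_field by auto
  have "\<forall>x. \<exists>L. ((\<lambda>y. ereal (?s f x y)) \<longlongrightarrow> L) (at_left x)"
    "\<forall>x. \<exists>L. ((\<lambda>y. ereal (?s f x y)) \<longlongrightarrow> L) (at_right x)"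
    by (intro allI slope_tendsto_ereal f)+
  from this[THEN choice] obtain l r where
    l: "\<And>x. ((\<lambda>y. ereal (?s f x y)) \<longlongrightarrow> l x) (at_left x)" and
    r: "\<And>x. ((\<lambda>y. ereal (?s f x y)) \<longlongrightarrow> r x) (at_right x)"
    by blast
  have minus: "ereal (?s (\<lambda>x. - f x) x y) = - ereal (?s f x y)" for x y
    by (simp flip: minus_divide_left) (simp add: minus_divide_left)
  \<comment> \<open>The one-sided slopes of \<open>- f\<close> are the negatives of those of
    \<open>f\<close>, so the same countability result covers the opposite inequality.\<close>
  have "countable {x. - l x < - r x}"
    by (rule countable_left_limit_less_right_limit[of "\<lambda>x. - f x"]; unfold minus)
      (intro tendsto_uminus_ereal l r)+
  then have "countable {x. r x < l x}"
    by (simp only: ereal_minus_less_minus)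
  then have "countable ({x. l x < r x} \<union> {x. r x < l x})"
    using countable_left_limit_less_right_limit[OF l r] by (rule countable_Un[rotated])
  moreover have *: "?inf f x \<or> ?inf (\<lambda>x. - f x) x" if x: "0 < x" "x < d" "l x = r x" for x
  proof (cases "l x")
    case (real D)
    then have "((\<lambda>y. ereal (?s f x y)) \<longlongrightarrow> ereal D) (at x)"
      using l[of x] r[of x] x(3) unfolding filterlim_at_split by simp
    then have "(f has_real_derivative D) (at x)"
      unfolding has_field_derivative_iff by simp
    then show ?thesis
      using d(2)[OF x(1,2)] unfolding field_differentiable_def by blast
  next
    case PInf
    then have "((\<lambda>y. ereal (?s f x y)) \<longlongrightarrow> \<infinity>) (at x)"
      using l[of x] r[of x] x(3) unfolding filterlim_at_split by simp
    then show ?thesis unfolding tendsto_PInfty by simp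
  next
    case MInf
    then have "((\<lambda>y. ereal (?s f x y)) \<longlongrightarrow> -\<infinity>) (at x)"
      using l[of x] r[of x] x(3) unfolding filterlim_at_split by simp
    then have "eventually (\<lambda>y. ?s f x y < - q) (at x)" for q
      unfolding tendsto_MInfty by simp
    moreover have "?s (\<lambda>x. - f x) x y = - ?s f x y" for y
      using minus[of y x] by (simp only: uminus_ereal.simps ereal.inject)
    ultimately have "eventually (\<lambda>y. q < ?s (\<lambda>x. - f x) x y) (at x)" for q
      by (simp only: less_minus_iff)
    then show ?thesis by (intro disjI2 allI)
  qed
  have "{x. x \<in> {0<..<d} \<and> \<not> (?inf f x \<or> ?inf (\<lambda>x. - f x) x)} \<subseteq> {x. l x < r x} \<union> {x. r x < l x}"
  proof (intro subsetI)
    fix x assume "x \<in> {x. x \<in> {0<..<d} \<and> \<not> (?inf f x \<or> ?inf (\<lambda>x. - f x) x)}"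
    with * have "l x \<noteq> r x" by auto
    then show "x \<in> {x. l x < r x} \<union> {x. r x < l x}" by (auto simp: neq_iff)
  qed
  ultimately have "eventually (\<lambda>x. ?inf f x \<or> ?inf (\<lambda>x. - f x) x) (at_right 0)"
    using d(1) countable_subset
    by (intro dpred_eventually_at_right_0[of _ d] dpred_disj dpred_infinite_slope f f') blast+
  \<comment> \<open>The dichotomy strengthens "not eventually of infinite slope" to "eventually not
    of infinite slope", for \<open>f\<close> and for \<open>- f\<close>. Both statements can then be
    combined with the disjunction.\<close>
  moreover have disjD: "P \<or> Q \<Longrightarrow> \<not> P \<Longrightarrow> Q" for P Q by blast
  note disjD[OF dpred_dichotomy_at_right[OF dpred_infinite_slope[OF f]]
      not_eventually_infinite_slope[of f]]
  moreover note disjD[OF dpred_dichotomy_at_right[OF dpred_infinite_slope[OF f']]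
      not_eventually_infinite_slope[of "\<lambda>x. - f x"]]
  ultimately have "eventually (\<lambda>x::real. False) (at_right 0)"
    by eventually_elim (rule disjE, assumption; erule (1) notE)
  then show False by simp
qed

text \<open>By the dichotomy the derivative is nonnegative throughout or negative throughout an
  interval \<open>(0, d)\<close> on which \<open>f\<close> is differentiable.\<close>

lemma eventually_monotone:
  fixes f :: "real \<Rightarrow> real"
  assumes f: "dfun f"
  shows "\<exists>d>0. mono_on {0<..<d} f \<or> mono_on {0<..<d} (\<lambda>x. - f x)"
proof -
  have "dpred (\<lambda>x. 0 \<le> deriv f x)"
    by (intro definable_intros dfun_deriv f)
  from dpred_dichotomy_at_right[OF this, of 0]
  have "eventually (\<lambda>x. f field_differentiable (at x) \<and> 0 \<le> deriv f x) (at_right 0)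
    \<or> eventually (\<lambda>x. f field_differentiable (at x) \<and> deriv f x \<le> 0) (at_right 0)"
  proof
    assume "eventually (\<lambda>x. 0 \<le> deriv f x) (at_right 0)"
    with eventually_differentiable[OF f] show ?thesis
      by (intro disjI1 eventually_conj)
  next
    assume "eventually (\<lambda>x. \<not> 0 \<le> deriv f x) (at_right 0)"
    then have "eventually (\<lambda>x. deriv f x \<le> 0) (at_right 0)"
      by eventually_elim simp
    with eventually_differentiable[OF f] show ?thesis
      by (intro disjI2 eventually_conj)
  qed
  then show ?thesis
  proof (elim disjE)
    assume "eventually (\<lambda>x. f field_differentiable (at x) \<and> 0 \<le> deriv f x) (at_right 0)"
    then obtain d where "d > 0" and d: "\<And>x. 0 < x \<Longrightarrow> x < d \<Longrightarrow>
        (f has_real_derivative deriv f x) (at x) \<and> 0 \<le> deriv f x"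
      unfolding eventually_at_right_field by (auto simp: field_differentiable_derivI)
    have "f x \<le> f y" if "0 < x" "x \<le> y" "y < d" for x y
      using that d by (intro DERIV_nonneg_imp_nondecreasing[of x y f]) (meson le_less_trans less_le_trans)+
    then show ?thesis
      using \<open>d > 0\<close> by (auto simp: mono_on_def)
  next
    assume "eventually (\<lambda>x. f field_differentiable (at x) \<and> deriv f x \<le> 0) (at_right 0)"
    then obtain d where "d > 0" and d: "\<And>x. 0 < x \<Longrightarrow> x < d \<Longrightarrow>
        (f has_real_derivative deriv f x) (at x) \<and> deriv f x \<le> 0"
      unfolding eventually_at_right_field by (auto simp: field_differentiable_derivI)
    have "f y \<le> f x" if "0 < x" "x \<le> y" "y < d" for x y
      using that d by (intro DERIV_nonpos_imp_nonincreasing[of x y f]) (meson le_less_trans less_le_trans)+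
    then show ?thesis
      using \<open>d > 0\<close> by (auto simp: mono_on_def)
  qed
qed

lemma deriv_power_bound:
  fixes g :: "real \<Rightarrow> real"
  assumes g: "dfun g" and bound: "eventually (\<lambda>t. \<bar>g t\<bar> \<le> C * t ^ Suc n) (at_right 0)"
  shows "\<exists>C'. eventually (\<lambda>t. \<bar>deriv g t\<bar> \<le> C' * t ^ n) (at_right 0)"
proof -
  from bound eventually_differentiable[OF g]
  have "eventually (\<lambda>t. \<bar>g t\<bar> \<le> C * t ^ Suc n \<and> g field_differentiable (at t)) (at_right 0)"
    by eventually_elim blast
  then obtain d where "d > 0" and d: "\<And>t. 0 < t \<Longrightarrow> t < d \<Longrightarrow> \<bar>g t\<bar> \<le> C * t ^ Suc n"
      "\<And>t. 0 < t \<Longrightarrow> t < d \<Longrightarrow> (g has_real_derivative deriv g t) (at t)"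
    unfolding eventually_at_right_field by (auto simp: field_differentiable_derivI)
  obtain e where "e > 0" and e: "mono_on {0<..<e} (deriv g) \<or> mono_on {0<..<e} (\<lambda>x. - deriv g x)"
    using eventually_monotone[OF dfun_deriv[OF g]] by blast
  \<comment> \<open>Evaluating the bound at points up to \<open>2 * t\<close> costs the factor
    \<open>2 ^ Suc n\<close>. The 4 accounts for two function values and for the length
    \<open>t / 2\<close> of the left interval.\<close>
  let ?C' = "4 * (C * 2 ^ Suc n)"
  \<comment> \<open>Halving \<open>min d e\<close> keeps \<open>2 * t\<close> inside both
    intervals.\<close>
  have "\<bar>deriv g t\<bar> \<le> ?C' * t ^ n" if t: "0 < t" "t < min d e / 2" for t
  proof -
    \<comment> \<open>By monotonicity \<open>deriv g t\<close> lies between mean values of \<open>deriv g\<close> over \<open>[t / 2, t]\<close> and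
      \<open>[t, 2 t]\<close>.\<close>
    obtain u where u: "t / 2 < u" "u < t" "g t - g (t / 2) = (t - t / 2) * deriv g u"
      using MVT2[of "t / 2" t g "deriv g"] d(2) t by auto
    obtain v where v: "t < v" "v < 2 * t" "g (2 * t) - g t = (2 * t - t) * deriv g v"
      using MVT2[of t "2 * t" g "deriv g"] d(2) t by auto
    have "0 \<le> C"
      using d(1)[of t] t abs_ge_zero[of "g t"] by (smt (verit) zero_less_power zero_le_mult_iff min_def field_sum_of_halves)
    let ?B = "C * (2 * t) ^ Suc n"
    have "\<bar>g s\<bar> \<le> ?B" if s: "0 < s" "s \<le> 2 * t" for s
    proof -
      have "C * s ^ Suc n \<le> ?B"
        using \<open>0 \<le> C\<close> s by (intro mult_left_mono power_mono) auto
      then show ?thesis using d(1)[of s] s t by auto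
    qed
    from this[of t] this[of "t / 2"] this[of "2 * t"]
    have "\<bar>g t\<bar> \<le> ?B" "\<bar>g (t / 2)\<bar> \<le> ?B" "\<bar>g (2 * t)\<bar> \<le> ?B"
      using t by auto
    then have "\<bar>t * deriv g u\<bar> \<le> 4 * ?B" "\<bar>t * deriv g v\<bar> \<le> 4 * ?B"
      using u(3) v(3) by (auto simp: abs_le_iff)
    moreover have "deriv g u \<le> deriv g t \<and> deriv g t \<le> deriv g v \<or>
        deriv g v \<le> deriv g t \<and> deriv g t \<le> deriv g u"
      using e u v t unfolding mono_on_def by auto
    then have "\<bar>deriv g t\<bar> \<le> max \<bar>deriv g u\<bar> \<bar>deriv g v\<bar>"
      by auto
    then have "t * \<bar>deriv g t\<bar> \<le> max \<bar>t * deriv g u\<bar> \<bar>t * deriv g v\<bar>"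
      using t(1) by (auto simp: abs_mult max_def split: if_splits)
    ultimately have "t * \<bar>deriv g t\<bar> \<le> 4 * ?B" by auto
    also have "\<dots> = t * (?C' * t ^ n)"
      by (simp add: power_mult_distrib)
    finally show ?thesis using t(1) by simp
  qed
  then show ?thesis
    using \<open>d > 0\<close> \<open>e > 0\<close> unfolding eventually_at_right_field
    by (intro exI[of _ ?C'] exI[of _ "min d e / 2"]) auto
qed

end

section \<open>Odd functions that are flat at the origin\<close>

text \<open>The \<open>k\<close>-th derivative exists on \<open>U\<close>, with no continuity
  clause, so that closure under products and composition is an induction on
  \<open>k\<close>.\<close>

definition times_differentiable_on :: "nat \<Rightarrow> (real \<Rightarrow> real) \<Rightarrow> real set \<Rightarrow> bool" where
  "times_differentiable_on k f U \<longleftrightarrow>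
    (\<forall>j<k. \<forall>x\<in>U. (deriv ^^ j) f field_differentiable (at x))"

lemma times_differentiable_on_0: "times_differentiable_on 0 f U"
  unfolding times_differentiable_on_def by simp

lemma times_differentiable_on_Suc:
  "times_differentiable_on (Suc k) f U \<longleftrightarrow>
    (\<forall>x\<in>U. (f has_real_derivative deriv f x) (at x)) \<and> times_differentiable_on k (deriv f) U"
  unfolding times_differentiable_on_def All_less_Suc2 funpow_Suc_right
  by (simp add: field_differentiable_derivI DERIV_deriv_iff_field_differentiable)

lemma times_differentiable_on_Suc_imp:
  "times_differentiable_on (Suc k) f U \<Longrightarrow> times_differentiable_on k f U"
  unfolding times_differentiable_on_def by simp

text \<open>On an open set, equality of two functions passes to their derivatives, hence to all
  orders.\<close>

lemma times_differentiable_on_cong: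
  assumes "open U" "\<And>x. x \<in> U \<Longrightarrow> f x = g x" "times_differentiable_on k f U"
  shows "times_differentiable_on k g U"
  using assms(2,3)
proof (induction k arbitrary: f g)
  case 0
  show ?case by (rule times_differentiable_on_0)
next
  case (Suc k)
  have g: "(g has_real_derivative deriv f x) (at x)" if "x \<in> U" for x
    using Suc.prems that assms(1) unfolding times_differentiable_on_Suc
    by (blast intro: has_field_derivative_transform_within_open)
  then have eq: "deriv f x = deriv g x" if "x \<in> U" for x
    using that DERIV_imp_deriv by metis
  have "times_differentiable_on k (deriv g) U"
    by (rule Suc.IH[OF eq]) (use Suc.prems(2) times_differentiable_on_Suc in blast)+
  then show ?case
    unfolding times_differentiable_on_Suc using g eq by simp
qed

text \<open>An explicit formula valid on \<open>U\<close> may replace \<open>deriv f\<close>; this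
  is the induction step of the closure rules that follow.\<close>

lemma times_differentiable_on_SucI:
  assumes "open U" "\<And>x. x \<in> U \<Longrightarrow> (f has_real_derivative f' x) (at x)"
    and "times_differentiable_on k f' U"
  shows "times_differentiable_on (Suc k) f U"
proof -
  have "deriv f x = f' x" if "x \<in> U" for x
    using assms(2)[OF that] by (rule DERIV_imp_deriv)
  then show ?thesis
    unfolding times_differentiable_on_Suc
    using assms times_differentiable_on_cong[of U f' "deriv f"] by simp
qed

lemma times_differentiable_on_const:
  assumes "open U"
  shows "times_differentiable_on k (\<lambda>x. c) U"
proof (induction k arbitrary: c)
  case (Suc k)
  then show ?case
    by (rule times_differentiable_on_SucI[OF assms DERIV_const])
qed (rule times_differentiable_on_0)

lemma times_differentiable_on_ident:
  assumes "open U"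
  shows "times_differentiable_on k (\<lambda>x. x) U"
proof (cases k)
  case (Suc j)
  show ?thesis unfolding Suc
    by (rule times_differentiable_on_SucI[OF assms DERIV_ident times_differentiable_on_const[OF assms]])
qed (simp add: times_differentiable_on_0)

lemma times_differentiable_on_add:
  assumes U: "open U"
  shows "times_differentiable_on k f U \<Longrightarrow> times_differentiable_on k g U
    \<Longrightarrow> times_differentiable_on k (\<lambda>x. f x + g x) U"
proof (induction k arbitrary: f g)
  case (Suc k)
  show ?case
  proof (rule times_differentiable_on_SucI[OF U])
    show "((\<lambda>x. f x + g x) has_real_derivative deriv f x + deriv g x) (at x)" if "x \<in> U" for x
      using that Suc.prems unfolding times_differentiable_on_Suc by (intro DERIV_add) auto
    show "times_differentiable_on k (\<lambda>x. deriv f x + deriv g x) U"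
      using Suc.prems unfolding times_differentiable_on_Suc by (intro Suc.IH) auto
  qed
qed (rule times_differentiable_on_0)

lemma times_differentiable_on_mult:
  assumes U: "open U"
  shows "times_differentiable_on k f U \<Longrightarrow> times_differentiable_on k g U
    \<Longrightarrow> times_differentiable_on k (\<lambda>x. f x * g x) U"
proof (induction k arbitrary: f g)
  case (Suc k)
  note low = Suc.prems[THEN times_differentiable_on_Suc_imp]
  show ?case
  proof (rule times_differentiable_on_SucI[OF U])
    show "((\<lambda>x. f x * g x) has_real_derivative deriv f x * g x + deriv g x * f x) (at x)"
      if "x \<in> U" for x
      using that Suc.prems unfolding times_differentiable_on_Suc by (intro DERIV_mult) auto
    show "times_differentiable_on k (\<lambda>x. deriv f x * g x + deriv g x * f x) U"
      using Suc.prems low unfolding times_differentiable_on_Suc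
      by (intro times_differentiable_on_add U Suc.IH) auto
  qed
qed (rule times_differentiable_on_0)

lemma times_differentiable_on_power:
  assumes "open U" "times_differentiable_on k f U"
  shows "times_differentiable_on k (\<lambda>x. f x ^ n) U"
proof (induction n)
  case 0
  show ?case using times_differentiable_on_const[OF assms(1)] by simp
next
  case (Suc n)
  show ?case using times_differentiable_on_mult[OF assms Suc] by simp
qed

text \<open>The chain rule produces \<open>deriv f (g x) * deriv g x\<close>, so the induction
  varies the outer function and keeps \<open>g\<close> fixed.\<close>

lemma times_differentiable_on_compose:
  assumes U: "open U" and sub: "\<And>x. x \<in> U \<Longrightarrow> g x \<in> V"
  shows "times_differentiable_on k f V \<Longrightarrow> times_differentiable_on k g U
    \<Longrightarrow> times_differentiable_on k (\<lambda>x. f (g x)) U"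
proof (induction k arbitrary: f)
  case (Suc k)
  note low = Suc.prems[THEN times_differentiable_on_Suc_imp]
  show ?case
  proof (rule times_differentiable_on_SucI[OF U])
    show "((\<lambda>x. f (g x)) has_real_derivative deriv f (g x) * deriv g x) (at x)" if "x \<in> U" for x
      using that sub Suc.prems unfolding times_differentiable_on_Suc
      by (intro DERIV_chain2[of f]) auto
    show "times_differentiable_on k (\<lambda>x. deriv f (g x) * deriv g x) U"
      using Suc.prems low unfolding times_differentiable_on_Suc
      by (intro times_differentiable_on_mult U Suc.IH[of "deriv f"]) auto
  qed
qed (rule times_differentiable_on_0)

lemma times_differentiable_on_inverse:
  assumes "0 \<notin> U" "open U"
  shows "times_differentiable_on k inverse U"
proof (induction k)
  case (Suc k)
  show ?case
  proof (rule times_differentiable_on_SucI[OF assms(2)])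
    show "(inverse has_real_derivative - 1 * (inverse x * inverse x)) (at x)" if "x \<in> U" for x :: real
    proof -
      have "x \<noteq> 0" using that assms(1) by auto
      from DERIV_inverse[OF this] show ?thesis by (simp add: power2_eq_square)
    qed
    show "times_differentiable_on k (\<lambda>x. - 1 * (inverse x * inverse x)) U"
      by (intro times_differentiable_on_mult times_differentiable_on_const Suc.IH assms(2))
  qed
qed (rule times_differentiable_on_0)

section \<open>Parity and behaviour at the origin\<close>

lemma DERIV_0_of_quadratic_bound:
  fixes h :: "real \<Rightarrow> real"
  assumes "h 0 = 0" "eventually (\<lambda>t. \<bar>h t\<bar> \<le> C * \<bar>t\<bar> ^ 2) (at 0)"
  shows "(h has_real_derivative 0) (at 0)"
proof -
  have "eventually (\<lambda>t. norm ((h t - h 0) / (t - 0)) \<le> C * \<bar>t\<bar>) (at 0)"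
    using assms(2) eventually_neq_at_within[of 0 0 UNIV]
    by eventually_elim (simp add: assms(1) divide_simps power2_eq_square)
  moreover have "((\<lambda>t :: real. C * \<bar>t\<bar>) \<longlongrightarrow> 0) (at 0)"
    by (auto intro!: tendsto_eq_intros)
  ultimately show ?thesis
    unfolding has_field_derivative_iff by (rule Lim_null_comparison)
qed

text \<open>Differentiating \<open>h (- y) = s * h y\<close> turns the parity sign \<open>s\<close>
  into \<open>- s\<close>. The symmetry is taken on positive arguments only, so that the result can
  be iterated without information at 0.\<close>

lemma deriv_reflect:
  fixes h :: "real \<Rightarrow> real"
  assumes sym: "\<And>y. 0 < y \<Longrightarrow> h (- y) = s * h y" and x: "0 < x"
    and h: "h field_differentiable (at x)"
  shows "(h has_real_derivative - s * deriv h x) (at (- x))"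
proof (rule has_field_derivative_transform_within_open[of "\<lambda>y. s * h (- y)" _ _ "{..<0}"])
  have "(h has_real_derivative deriv h x) (at (- (- x)))"
    using h by (simp add: DERIV_deriv_iff_field_differentiable)
  from DERIV_cmult[OF DERIV_chain2[OF this DERIV_minus[OF DERIV_ident]], of s]
  show "((\<lambda>y. s * h (- y)) has_real_derivative - s * deriv h x) (at (- x))" by simp
  show "s * h (- y) = h y" if "y \<in> {..<0}" for y
    using sym[of "- y"] that by simp
qed (use x in auto)

text \<open>An odd function starts with the sign \<open>- 1\<close> and every derivative flips it,
  hence the exponent \<open>Suc j\<close>.\<close>

lemma funpow_deriv_reflect:
  fixes f :: "real \<Rightarrow> real"
  assumes "\<And>t. f (- t) = - f t" and "times_differentiable_on (Suc p) f {0<..}" and "j \<le> p" "0 < x"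
  shows "(deriv ^^ j) f (- x) = (- 1) ^ Suc j * (deriv ^^ j) f x"
    and "(deriv ^^ j) f field_differentiable (at (- x))"
proof -
  have d: "(deriv ^^ i) f field_differentiable (at x)" if "i \<le> p" "0 < x" for i x
    using assms(2) that unfolding times_differentiable_on_def by auto
  have *: "(deriv ^^ j) f (- x) = (- 1) ^ Suc j * (deriv ^^ j) f x"
    if "j \<le> p" "0 < x" for j x
    using that
  proof (induction j arbitrary: x)
    case 0
    then show ?case using assms(1) by simp
  next
    case (Suc j)
    then have "((deriv ^^ j) f has_real_derivative - ((- 1) ^ Suc j) * deriv ((deriv ^^ j) f) x) (at (- x))"
      by (intro deriv_reflect d) auto
    from DERIV_imp_deriv[OF this] show ?case by simp
  qed
  show "(deriv ^^ j) f (- x) = (- 1) ^ Suc j * (deriv ^^ j) f x"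
    using * assms(3,4) by blast
  have "((deriv ^^ j) f has_real_derivative - ((- 1) ^ Suc j) * deriv ((deriv ^^ j) f) x) (at (- x))"
    using assms(3,4) by (intro deriv_reflect d *) auto
  then show "(deriv ^^ j) f field_differentiable (at (- x))"
    unfolding field_differentiable_def by blast
qed

lemma surj_of_odd_unbounded:
  fixes f :: "real \<Rightarrow> real"
  assumes odd: "\<And>t. f (- t) = - f t" and cont: "continuous_on UNIV f"
    and unb: "\<And>y. \<exists>t\<ge>0. y \<le> f t"
  shows "surj f"
proof -
  have f0: "f 0 = 0" using odd[of 0] by simp
  have pos: "\<exists>x. f x = y" if "0 \<le> y" for y
  proof -
    obtain t where "t \<ge> 0" "y \<le> f t" using unb by blast
    then show ?thesis
      using IVT'[of f 0 y t] f0 that continuous_on_subset[OF cont] by auto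
  qed
  have "\<exists>x. f x = y" for y
  proof (cases "0 \<le> y")
    case False
    then obtain x where "f x = - y" using pos[of "- y"] by auto
    then have "f (- x) = y" using odd by simp
    then show ?thesis by blast
  qed (rule pos)
  then show ?thesis unfolding surj_def by (metis (full_types))
qed

section \<open>Odd definable functions of class C^p\<close>

context o_minimal_structure
begin

lemma dfun_funpow_deriv:
  fixes f :: "real \<Rightarrow> real"
  assumes "dfun f"
  shows "dfun ((deriv ^^ j) f)"
proof (induction j)
  case (Suc j)
  then show ?case using dfun_deriv by simp
qed (simp add: assms)

text \<open>Iterated derivatives are definable, so each is differentiable near 0, and only finitely
  many conditions have to hold together.\<close>

lemma eventually_times_differentiable:
  fixes f :: "real \<Rightarrow> real"
  assumes "dfun f"
  shows "\<exists>d>0. times_differentiable_on k f {0<..<d}"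
proof -
  have "eventually (\<lambda>x. \<forall>j\<in>{..<k}. (deriv ^^ j) f field_differentiable (at x)) (at_right 0)"
    using eventually_differentiable[OF dfun_funpow_deriv[OF assms]]
    by (intro eventually_ball_finite) auto
  then show ?thesis
    unfolding eventually_at_right_field times_differentiable_on_def by auto
qed

lemma funpow_deriv_power_bound:
  fixes f :: "real \<Rightarrow> real"
  assumes "dfun f" "eventually (\<lambda>t. \<bar>f t\<bar> \<le> C * t ^ n) (at_right 0)" "j \<le> n"
  shows "\<exists>C'. eventually (\<lambda>t. \<bar>(deriv ^^ j) f t\<bar> \<le> C' * t ^ (n - j)) (at_right 0)"
  using assms(3)
proof (induction j)
  case 0
  then show ?case using assms(2) by auto
next
  case (Suc j)
  moreover have "n - j = Suc (n - Suc j)" using Suc.prems by simp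
  ultimately show ?case
    using deriv_power_bound[OF dfun_funpow_deriv[OF assms(1)], of j _ "n - Suc j"] by auto
qed

text \<open>Each derivative costs one power of \<open>t\<close>, so the \<open>j\<close>-th is of
  order \<open>\<bar>t\<bar> ^ (Suc p - j)\<close> on both sides of 0 by parity. For
  \<open>j < p\<close> the exponent is at least 2, which gives derivative 0 at the origin; for
  \<open>j = p\<close> it is 1, which gives continuity there.\<close>

lemma odd_flat_class_C:
  fixes f :: "real \<Rightarrow> real"
  assumes f: "dfun f" and odd: "\<And>t. f (- t) = - f t"
    and diff: "times_differentiable_on (Suc p) f {0<..}"
    and flat: "eventually (\<lambda>t. \<bar>f t\<bar> \<le> C * t ^ Suc p) (at_right 0)"
  shows "of_class_C p f" "\<And>k. k \<le> p \<Longrightarrow> (deriv ^^ k) f 0 = 0"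
proof -
  have bound: "\<exists>C'. eventually (\<lambda>t. \<bar>(deriv ^^ j) f t\<bar> \<le> C' * \<bar>t\<bar> ^ (Suc p - j)) (at 0)" if j: "j \<le> p" for j
  proof -
    obtain C' where "eventually (\<lambda>t. \<bar>(deriv ^^ j) f t\<bar> \<le> C' * t ^ (Suc p - j)) (at_right 0)"
      using funpow_deriv_power_bound[OF f flat, of j] j by auto
    then obtain d where "d > 0"
      and d: "\<And>t. 0 < t \<Longrightarrow> t < d \<Longrightarrow> \<bar>(deriv ^^ j) f t\<bar> \<le> C' * t ^ (Suc p - j)"
      unfolding eventually_at_right_field by auto
    have "\<bar>(deriv ^^ j) f t\<bar> \<le> C' * \<bar>t\<bar> ^ (Suc p - j)" if t: "t \<noteq> 0" "\<bar>t\<bar> < d" for t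
    proof (cases "0 < t")
      case False
      then have "\<bar>(deriv ^^ j) f t\<bar> = \<bar>(deriv ^^ j) f (- t)\<bar>"
        using funpow_deriv_reflect(1)[OF odd diff j, of "- t"] t by (simp add: abs_mult power_abs)
      then show ?thesis using d[of "- t"] False t by simp
    qed (use d t in simp)
    then show ?thesis
      using \<open>d > 0\<close> unfolding eventually_at dist_real_def by auto
  qed
  have step: "((deriv ^^ j) f has_real_derivative 0) (at 0)"
    if j: "j < p" "(deriv ^^ j) f 0 = 0" for j
  proof -
    obtain C' where C': "eventually (\<lambda>t. \<bar>(deriv ^^ j) f t\<bar> \<le> C' * \<bar>t\<bar> ^ (Suc p - j)) (at 0)"
      using bound[of j] j by auto
    have "eventually (\<lambda>t :: real. \<bar>t\<bar> < 1) (at 0)"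
      unfolding eventually_at dist_real_def by (intro exI[of _ 1]) simp
    with C' have "eventually (\<lambda>t. \<bar>(deriv ^^ j) f t\<bar> \<le> \<bar>C'\<bar> * \<bar>t\<bar> ^ 2) (at 0)"
    proof eventually_elim
      case (elim t)
      have "\<bar>t\<bar> ^ (Suc p - j) \<le> \<bar>t\<bar> ^ 2"
        using elim j by (intro power_decreasing) auto
      then have "\<bar>C'\<bar> * \<bar>t\<bar> ^ (Suc p - j) \<le> \<bar>C'\<bar> * \<bar>t\<bar> ^ 2"
        by (intro mult_left_mono) auto
      moreover have "C' * \<bar>t\<bar> ^ (Suc p - j) \<le> \<bar>C'\<bar> * \<bar>t\<bar> ^ (Suc p - j)"
        by (intro mult_right_mono) auto
      ultimately show ?case using elim by linarith
    qed
    with j(2) show ?thesis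
      by (rule DERIV_0_of_quadratic_bound[where h = "(deriv ^^ j) f"])
  qed
  show zero: "(deriv ^^ k) f 0 = 0" if "k \<le> p" for k
    using that
  proof (induction k)
    case 0
    show ?case using odd[of 0] by simp
  next
    case (Suc k)
    then show ?case using DERIV_imp_deriv[OF step[of k]] by simp
  qed
  have nonzero: "(deriv ^^ j) f field_differentiable (at x)" if "j \<le> p" "x \<noteq> 0" for j x
  proof (cases "0 < x")
    case True
    then show ?thesis using diff that unfolding times_differentiable_on_def by auto
  next
    case False
    then show ?thesis using funpow_deriv_reflect(2)[OF odd diff that(1), of "- x"] that by simp
  qed
  show "of_class_C p f"
    unfolding of_class_C_def
  proof (intro conjI allI impI)
    fix k x assume "k < p"
    then show "(deriv ^^ k) f field_differentiable (at x)"
      using nonzero[of k x] step[of k] zero[of k] unfolding field_differentiable_def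
      by (cases "x = 0") auto
  next
    obtain C' where C': "eventually (\<lambda>t. \<bar>(deriv ^^ p) f t\<bar> \<le> C' * \<bar>t\<bar>) (at 0)"
      using bound[of p] by auto
    have "((\<lambda>t :: real. C' * \<bar>t\<bar>) \<longlongrightarrow> 0) (at 0)"
      by (auto intro!: tendsto_eq_intros)
    then have "((deriv ^^ p) f \<longlongrightarrow> 0) (at 0)"
      by (rule Lim_null_comparison[rotated]) (use C' in simp)
    then have "isCont ((deriv ^^ p) f) 0"
      unfolding isCont_def using zero by simp
    then have "isCont ((deriv ^^ p) f) x" for x
      using field_differentiable_imp_continuous_at[OF nonzero[of p x]] by (cases "x = 0") simp_all
    then show "continuous_on UNIV ((deriv ^^ p) f)"
      by (simp add: continuous_at_imp_continuous_on)
  qed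
qed

section \<open>Construction of a minorant in the class \<open>Phi p\<close>\<close>

lemma exists_Phi_below:
  fixes m :: "real \<Rightarrow> real"
  assumes m: "dfun m" and pos: "\<And>t. 0 < t \<Longrightarrow> 0 < m t" and le_1: "\<And>t. 0 < t \<Longrightarrow> m t \<le> 1"
    and mono: "\<And>s t. 0 < s \<Longrightarrow> s \<le> t \<Longrightarrow> m s \<le> m t" and M: "0 < M"
  shows "\<exists>\<phi>\<in>Phi p. dfun \<phi> \<and> (\<forall>t. 0 < t \<and> t \<le> M \<longrightarrow> \<phi> t \<le> m t)"
proof -
  obtain d where d: "d > 0" "times_differentiable_on (Suc p) m {0<..<d}"
    using eventually_times_differentiable[OF m] by blast
  \<comment> \<open>The bound \<open>e \<le> d\<close> keeps \<open>\<sigma>\<close> where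
    \<open>m\<close> is differentiable, and \<open>e \<le> 1\<close> yields
    \<open>\<sigma> t \<le> t\<close>.\<close>
  define e where "e = min d 1"
  have e: "0 < e" "e \<le> d" "e \<le> 1" using d(1) unfolding e_def by auto
  \<comment> \<open>This maps the positive half-line increasingly into \<open>(0, e)\<close>, so
    \<open>m (\<sigma> t)\<close> is differentiable \<open>Suc p\<close> times for all
    \<open>t > 0\<close>.\<close>
  define \<sigma> where "\<sigma> t = e * t * inverse (1 + t)" for t
  \<comment> \<open>The power provides flatness at 0, strict growth and unboundedness, and it is at
    most 1 for \<open>t \<le> M\<close>, where \<open>g\<close> must stay below
    \<open>m\<close>.\<close>
  define g where "g t = (t * inverse M) ^ Suc p * m (\<sigma> t)" for t
  define \<phi> where "\<phi> t = (if 0 < t then g t else if t = 0 then 0 else - g (- t))" for t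
  have \<sigma>: "0 < \<sigma> t" "\<sigma> t < e" "\<sigma> t \<le> t" if "0 < t" for t
  proof -
    show "0 < \<sigma> t" "\<sigma> t < e" using that e unfolding \<sigma>_def by (auto simp: field_simps)
    have "e * t \<le> 1 * t" using that e by (intro mult_right_mono) auto
    also have "\<dots> \<le> t * (1 + t)" using that by (simp add: algebra_simps)
    finally show "\<sigma> t \<le> t" using that unfolding \<sigma>_def by (simp add: field_simps)
  qed
  have \<sigma>_mono: "\<sigma> s \<le> \<sigma> t" if "0 < s" "s \<le> t" for s t
    using that e unfolding \<sigma>_def by (simp add: field_simps)
  have g_pos: "0 < g t" if "0 < t" for t
    using pos[OF \<sigma>(1)[OF that]] that M unfolding g_def by simp
  have g_strict: "g s < g t" if st: "0 < s" "s < t" for s t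
  proof -
    have "(s * inverse M) ^ Suc p < (t * inverse M) ^ Suc p"
      using st M by (intro power_strict_mono mult_strict_right_mono) auto
    moreover have "m (\<sigma> s) \<le> m (\<sigma> t)" "0 < m (\<sigma> s)"
      using st \<sigma>(1) \<sigma>_mono by (auto intro!: mono pos)
    ultimately show ?thesis
      using st M unfolding g_def by (intro mult_less_le_imp_less) auto
  qed
  have odd: "\<phi> (- t) = - \<phi> t" for t unfolding \<phi>_def by auto
  have "dfun g"
    unfolding g_def \<sigma>_def inverse_eq_divide
    by (intro definable_intros dfun_compose[OF m])
  then have dfun_\<phi>: "dfun \<phi>"
    unfolding \<phi>_def by (intro definable_intros dfun_compose[OF \<open>dfun g\<close>])
  have U: "open {0::real<..}" by simp
  have "times_differentiable_on (Suc p) (\<lambda>t. inverse (1 + t)) {0<..}"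
  proof (rule times_differentiable_on_compose[OF U, of "\<lambda>t. 1 + t" "{0<..}" "Suc p" inverse])
    show "times_differentiable_on (Suc p) inverse {0<..}"
      by (rule times_differentiable_on_inverse) auto
    show "times_differentiable_on (Suc p) (\<lambda>t. 1 + t) {0<..}"
      by (intro times_differentiable_on_add times_differentiable_on_const
        times_differentiable_on_ident U)
  qed simp
  then have "times_differentiable_on (Suc p) \<sigma> {0<..}"
    unfolding \<sigma>_def by (intro times_differentiable_on_mult times_differentiable_on_const
        times_differentiable_on_ident U)
  then have "times_differentiable_on (Suc p) (\<lambda>t. m (\<sigma> t)) {0<..}"
    using \<sigma> e by (intro times_differentiable_on_compose[OF U _ d(2)]) fastforce+
  then have "times_differentiable_on (Suc p) g {0<..}"
    unfolding g_def by (intro times_differentiable_on_mult times_differentiable_on_power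
        times_differentiable_on_const times_differentiable_on_ident U)
  then have diff: "times_differentiable_on (Suc p) \<phi> {0<..}"
    by (rule times_differentiable_on_cong[OF U, rotated]) (simp add: \<phi>_def)
  have g_le: "g t \<le> (t * inverse M) ^ Suc p" if "0 < t" for t
  proof -
    have "(t * inverse M) ^ Suc p * m (\<sigma> t) \<le> (t * inverse M) ^ Suc p * 1"
      using that M \<sigma>(1) le_1 by (intro mult_left_mono) auto
    then show ?thesis unfolding g_def by simp
  qed
  have "\<bar>\<phi> t\<bar> \<le> inverse M ^ Suc p * t ^ Suc p" if "0 < t" for t
  proof -
    have "\<bar>\<phi> t\<bar> = g t" using that g_pos[OF that] unfolding \<phi>_def by simp
    then show ?thesis
      using g_le[OF that] by (simp only: power_mult_distrib mult.commute)
  qed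
  then have "eventually (\<lambda>t. \<bar>\<phi> t\<bar> \<le> inverse M ^ Suc p * t ^ Suc p) (at_right 0)"
    unfolding eventually_at_right_field by (intro exI[of _ 1]) simp
  note C = odd_flat_class_C[OF dfun_\<phi> odd diff this]
  have strict: "strict_mono \<phi>"
  proof (rule strict_monoI)
    fix s t :: real assume "s < t"
    then consider "0 < s" | "s \<le> 0" "0 < t" | "t \<le> 0" by linarith
    then show "\<phi> s < \<phi> t"
    proof cases
      case 2
      then show ?thesis
        using g_pos[of t] g_pos[of "- s"] unfolding \<phi>_def by auto
    next
      case 3
      then show ?thesis
        using \<open>s < t\<close> g_pos[of "- s"] g_strict[of "- t" "- s"]
        unfolding \<phi>_def by (cases "t = 0") simp_all
    qed (use \<open>s < t\<close> g_strict in \<open>simp add: \<phi>_def\<close>)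
  qed
  have "continuous_on UNIV \<phi>"
  proof (cases p)
    case 0
    then show ?thesis using C(1) unfolding of_class_C_def by simp
  next
    case (Suc q)
    then have "(deriv ^^ 0) \<phi> field_differentiable (at x)" for x
      using C(1) unfolding of_class_C_def by blast
    then have "\<phi> field_differentiable (at x)" for x
      by simp
    then show ?thesis
      by (simp add: continuous_at_imp_continuous_on field_differentiable_imp_continuous_at)
  qed
  moreover have "\<exists>t\<ge>0. y \<le> \<phi> t" for y
  proof -
    define c where "c = m (\<sigma> 1)"
    have c: "0 < c" using pos \<sigma>(1) unfolding c_def by simp
    \<comment> \<open>With \<open>t \<ge> M\<close> the base \<open>t / M\<close> is at least 1, so
      its power dominates it; the third entry makes the base at least \<open>y / c\<close>, and
      \<open>t \<ge> 1\<close> gives \<open>m (\<sigma> t) \<ge> c\<close>.\<close>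
    define t where "t = max 1 (max M (M * (y / c)))"
    have t: "1 \<le> t" "M \<le> t" "M * (y / c) \<le> t" unfolding t_def by auto
    have "y / c \<le> t * inverse M" using t(3) M by (simp add: field_simps)
    also have "\<dots> \<le> (t * inverse M) ^ Suc p"
      using t(2) M by (intro self_le_power) (auto simp: field_simps)
    finally have "y \<le> (t * inverse M) ^ Suc p * c" using c by (simp add: field_simps)
    also have "\<dots> \<le> g t"
      using t(1) M \<sigma>(1) \<sigma>_mono unfolding g_def c_def by (intro mult_left_mono mono) auto
    finally show ?thesis using t(1) unfolding \<phi>_def by (intro exI[of _ t]) auto
  qed
  ultimately have "surj \<phi>" by (intro surj_of_odd_unbounded odd)
  then have "bij \<phi>"
    using strict by (simp add: bij_def strict_mono_imp_inj_on)
  then have "\<phi> \<in> Phi p"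
    unfolding Phi_def using odd strict C by auto
  moreover have "\<phi> t \<le> m t" if t: "0 < t" "t \<le> M" for t
  proof -
    have "t * inverse M \<le> 1" "0 \<le> t * inverse M"
      using t M by (simp_all add: field_simps)
    then have "(t * inverse M) ^ Suc p \<le> 1"
      by (intro power_le_one)
    then have "(t * inverse M) ^ Suc p * m (\<sigma> t) \<le> 1 * m (\<sigma> t)"
      using pos[OF \<sigma>(1)[OF t(1)]] by (intro mult_right_mono) auto
    then have "g t \<le> m (\<sigma> t)"
      unfolding g_def by simp
    also have "\<dots> \<le> m t" using \<sigma>[OF t(1)] by (intro mono)
    finally show ?thesis using t unfolding \<phi>_def by simp
  qed
  ultimately show ?thesis using dfun_\<phi> by blast
qed

end

section \<open>Multifunctions\<close>

text \<open>The Kuratowski limit admits only sequences avoiding \<open>b\<close>, while here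
  \<open>x n = b\<close> may occur. If \<open>l\<close> were outside the closed set
  \<open>F b\<close>, then so would be \<open>y n\<close> for large \<open>n\<close>, which forces
  \<open>x n \<noteq> b\<close>, and a tail of the sequence is admissible.\<close>

lemma outer_semicontinuous_limit:
  fixes F :: "'a::topological_space \<Rightarrow> 'b::topological_space set"
  assumes osc: "outer_semicontinuous F" and b: "b \<in> mdom F" "closed (F b)"
    and x: "x \<longlonglongrightarrow> b" and y: "\<And>n. y n \<in> F (x n)" "y \<longlonglongrightarrow> l"
  shows "l \<in> F b"
proof (rule ccontr)
  assume l: "l \<notin> F b"
  then have "eventually (\<lambda>n. y n \<in> - F b) sequentially"
    using b(2) by (intro topological_tendstoD[OF y(2)]) (auto simp: open_Compl)
  then obtain N where "\<And>n. n \<ge> N \<Longrightarrow> y n \<notin> F b"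
    unfolding eventually_sequentially by auto
  then have N: "x (n + N) \<in> mdom F - {b}" for n
    using y(1)[of "n + N"] unfolding mdom_def by force
  have "(\<lambda>n. x (n + N)) \<longlonglongrightarrow> b" "(\<lambda>n. y (n + N)) \<longlonglongrightarrow> l"
    using x y(2) by (auto intro: LIMSEQ_ignore_initial_segment)
  then have "l \<in> kuratowski_limsup F b"
    unfolding kuratowski_limsup_def using N y(1)
    by (intro CollectI exI[of _ "\<lambda>n. x (n + N)"] exI[of _ "\<lambda>n. y (n + N)"]) simp
  then show False
    using osc b(1) l unfolding outer_semicontinuous_def by blast
qed

text \<open>Otherwise the radii \<open>1 / (n + 1)\<close> give points of \<open>K\<close> that
  subconverge to some \<open>b\<close>. Every point of \<open>B\<close> is a limit of points of
  \<open>F (x n)\<close>, so \<open>B \<subseteq> F b\<close> and \<open>b\<close> lies in the upper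
  preimage, although the sequence keeps distance \<open>t\<close> from it.\<close>

lemma excess_bounded_below:
  fixes F :: "'a::heine_borel \<Rightarrow> 'b::heine_borel set"
  assumes osc: "outer_semicontinuous F" and cl: "\<And>x. closed (F x)"
    and K: "compact K" "K \<subseteq> mdom F" and t: "0 < t"
  shows "\<exists>r>0. \<forall>x\<in>K. (\<forall>u\<in>upper_preimage F B. t \<le> dist x u) \<longrightarrow>
    \<not> (\<forall>y\<in>B. \<exists>z\<in>F x. dist y z \<le> r)"
proof (rule ccontr)
  assume "\<not> ?thesis"
  then have "\<exists>x. x \<in> K \<and> (\<forall>u\<in>upper_preimage F B. t \<le> dist x u) \<and>
      (\<forall>y\<in>B. \<exists>z\<in>F x. dist y z \<le> inverse (real (Suc n)))" for n
    using inverse_positive_iff_positive[of "real (Suc n)"] of_nat_0_less_iff[of "Suc n"] by blast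
  then obtain x where xK: "\<And>n. x n \<in> K"
    and far: "\<And>n u. u \<in> upper_preimage F B \<Longrightarrow> t \<le> dist (x n) u"
    and near: "\<And>n y. y \<in> B \<Longrightarrow> \<exists>z\<in>F (x n). dist y z \<le> inverse (real (Suc n))"
    by metis
  obtain b s where b: "b \<in> K" "strict_mono s" and lim: "(x \<circ> s) \<longlonglongrightarrow> b"
    using seq_compactE[OF compact_imp_seq_compact[OF K(1)], of x] xK by metis
  have "B \<subseteq> F b"
  proof
    fix y assume "y \<in> B"
    then obtain z where z: "\<And>n. z n \<in> F (x n)" "\<And>n. dist y (z n) \<le> inverse (real (Suc n))"
      using near by metis
    have "(\<lambda>n. dist (z n) y) \<longlonglongrightarrow> 0"
      using z(2) by (intro Lim_null_comparison[OF _ LIMSEQ_inverse_real_of_nat])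
        (auto simp: dist_commute)
    then have "z \<longlonglongrightarrow> y"
      by (simp add: tendsto_dist_iff[of z])
    then have "(z \<circ> s) \<longlonglongrightarrow> y"
      using b(2) by (rule LIMSEQ_subseq_LIMSEQ)
    then show "y \<in> F b"
      using outer_semicontinuous_limit[OF osc _ cl lim, of "z \<circ> s" y] z(1) b(1) K(2) by auto
  qed
  then have "t \<le> dist ((x \<circ> s) n) b" for n
    using far[of b] by (simp add: upper_preimage_def)
  moreover have "(\<lambda>n. dist ((x \<circ> s) n) b) \<longlonglongrightarrow> 0"
    using lim by (simp add: tendsto_dist_iff[of "x \<circ> s"])
  ultimately have "t \<le> 0"
    by (intro LIMSEQ_le_const[of _ 0 t]) auto
  then show False using t by simp
qed

lemma infdist_le_hausdorff_dist:
  fixes A B :: "'a::metric_space set"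
  assumes "compact B" "y \<in> B"
  shows "infdist y A \<le> hausdorff_dist A B"
proof -
  have "bdd_above ((\<lambda>x. infdist x A) ` B)"
    using assms(1) by (intro bounded_imp_bdd_above compact_imp_bounded compact_continuous_image
        continuous_intros)
  then have "infdist y A \<le> (SUP x\<in>B. infdist x A)"
    using assms(2) by (rule cSUP_upper2) simp
  then show ?thesis unfolding hausdorff_dist_def by simp
qed

theorem theorem5p13:
  fixes S :: "nat \<Rightarrow> real list set set"
    and F :: "real ^ 'm \<Rightarrow> (real ^ 'n) set"
    and a :: "real ^ 'm"
    and K :: "(real ^ 'm) set"
    and p :: nat
  assumes "o_minimal_structure S"
    and "p \<ge> 1"
    and "definable_multifun S F"
    and "outer_semicontinuous F"
    and "\<And>x. compact (F x)"
    and "a \<in> mdom F"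
    and "definable S K"
    and "compact K"
    and "a \<in> interior K"
    and "K \<subseteq> mdom F"
  shows "\<exists>\<phi>\<in>Phi p. definable_fun S \<phi> \<and>
    (\<forall>x\<in>K. hausdorff_dist (F x) (F a) \<ge> \<phi> (infdist x (upper_preimage F (F a))))"
proof -
  interpret o_minimal_structure S by fact
  let ?U = "upper_preimage F (F a)"
  have U: "a \<in> ?U" by (simp add: upper_preimage_def)
  have F: "dpred (\<lambda>z. snd z \<in> F (fst z))"
    using assms(3) unfolding definable_multifun_def by (simp add: case_prod_unfold)
  have K: "dpred (\<lambda>x. x \<in> K)" using assms(7) by simp
  \<comment> \<open>Apart from \<open>1 \<le> r\<close>, this says that the excess of
    \<open>F a\<close> over some \<open>F x\<close> is bounded by \<open>r\<close>, with
    \<open>x\<close> in \<open>K\<close> at distance at least \<open>t\<close> from the upper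
    preimage. The alternative \<open>1 \<le> r\<close> makes the set of such \<open>r\<close>
    nonempty and caps its infimum at 1. Quantifiers are written out so that the formula rules
    apply.\<close>
  define Q where "Q t r \<longleftrightarrow> 1 \<le> r \<or> (0 \<le> r \<and> (\<exists>x. x \<in> K \<and>
      (\<forall>u. (\<forall>y. y \<in> F a \<longrightarrow> y \<in> F u) \<longrightarrow> t \<le> dist x u) \<and>
      (\<forall>y. y \<in> F a \<longrightarrow> (\<exists>z. z \<in> F x \<and> dist y z \<le> r))))" for t r
  have Q_iff: "Q t r \<longleftrightarrow> 1 \<le> r \<or> (0 \<le> r \<and> (\<exists>x\<in>K. (\<forall>u\<in>?U. t \<le> dist x u) \<and>
      (\<forall>y\<in>F a. \<exists>z\<in>F x. dist y z \<le> r)))" for t r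
    unfolding Q_def upper_preimage_def by (simp add: subset_iff Ball_def Bex_def)
  have Q: "dpred (\<lambda>z. Q (fst z) (snd z))"
    unfolding Q_def
    by (intro definable_intros dpred_compose[OF K] dpred_compose2[OF F])
  define m where "m t = Inf {r. Q t r}" for t
  have Q_nonneg: "0 \<le> r" if "Q t r" for t r using that unfolding Q_def by auto
  then have bdd: "bdd_below {r. Q t r}" for t by (intro bdd_belowI[of _ 0]) simp
  have Q1: "Q t 1" for t unfolding Q_def by simp
  have m_le: "m t \<le> r" if "Q t r" for t r
    unfolding m_def using that bdd by (intro cInf_lower) auto
  have m: "dfun m"
    unfolding m_def using Q Q1 bdd by (intro dfun_Inf) blast+
  have m_pos: "0 < m t" if t: "0 < t" for t
  proof -
    obtain r where r: "r > 0" "\<And>x. x \<in> K \<Longrightarrow> \<forall>u\<in>?U. t \<le> dist x u \<Longrightarrow>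
        \<not> (\<forall>y\<in>F a. \<exists>z\<in>F x. dist y z \<le> r)"
      using excess_bounded_below[OF assms(4) compact_imp_closed[OF assms(5)] assms(8,10) t, of "F a"]
      by blast
    \<comment> \<open>The two entries of the minimum correspond to the two alternatives of
      \<open>Q\<close>.\<close>
    have "min 1 r \<le> s" if "Q t s" for s
    proof (rule ccontr)
      assume "\<not> ?thesis"
      then have "s < 1" "s < r" by auto
      with that obtain x where "x \<in> K" "\<forall>u\<in>?U. t \<le> dist x u" "\<forall>y\<in>F a. \<exists>z\<in>F x. dist y z \<le> s"
        unfolding Q_iff by auto
      moreover from this(3) \<open>s < r\<close> have "\<forall>y\<in>F a. \<exists>z\<in>F x. dist y z \<le> r"
        by (meson less_imp_le order_trans)
      ultimately show False using r(2) by blast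
    qed
    then have "min 1 r \<le> m t"
      unfolding m_def using Q1 by (intro cInf_greatest) auto
    then show ?thesis using r(1) by auto
  qed
  \<comment> \<open>A larger \<open>t\<close> admits fewer points \<open>x\<close>, so the infimum
    is taken over a smaller set.\<close>
  have m_mono: "m s \<le> m t" if "s \<le> t" for s t
  proof -
    have "Q s r" if "Q t r" for r
      using that \<open>s \<le> t\<close> unfolding Q_iff by (meson order_trans)
    then show ?thesis
      unfolding m_def using Q1 bdd by (intro cInf_superset_mono) auto
  qed
  \<comment> \<open>Since \<open>a\<close> lies in the upper preimage, a bound for the distance to
    \<open>a\<close> also bounds the distance to the upper preimage.\<close>
  obtain M where M: "0 < M" "\<And>x. x \<in> K \<Longrightarrow> dist a x \<le> M"
  proof -
    obtain e where "\<And>x. x \<in> K \<Longrightarrow> dist a x \<le> e"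
      using compact_imp_bounded[OF assms(8)] unfolding bounded_any_center[of _ a] by blast
    then show ?thesis by (intro that[of "max e 1"]) (auto intro: max.coboundedI1)
  qed
  obtain \<phi> where \<phi>: "\<phi> \<in> Phi p" "dfun \<phi>" "\<And>t. 0 < t \<Longrightarrow> t \<le> M \<Longrightarrow> \<phi> t \<le> m t"
    using exists_Phi_below[OF m m_pos m_le[OF Q1] m_mono M(1), of p] by blast
  have "\<phi> (infdist x ?U) \<le> hausdorff_dist (F x) (F a)" if x: "x \<in> K" for x
  proof -
    let ?h = "hausdorff_dist (F x) (F a)"
    obtain y where "y \<in> F a" using assms(6) unfolding mdom_def by auto
    then have h: "0 \<le> ?h"
      using infdist_le_hausdorff_dist[OF assms(5), of y a "F x"] infdist_nonneg[of y "F x"] by linarith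
    show ?thesis
    proof (cases "infdist x ?U = 0")
      case True
      have "\<phi> (- 0) = - \<phi> 0" using \<phi>(1) unfolding Phi_def by blast
      then show ?thesis using h True by simp
    next
      case False
      then have pos: "0 < infdist x ?U"
        using infdist_nonneg[of x ?U] by linarith
      have "infdist x ?U \<le> M"
        using infdist_le[OF U, of x] M(2)[OF x] by (simp add: dist_commute)
      then have "\<phi> (infdist x ?U) \<le> m (infdist x ?U)"
        using \<phi>(3) pos by blast
      \<comment> \<open>The point \<open>x\<close> itself is the witness at its own distance from
        the upper preimage; nearest points in the compact set \<open>F x\<close> supply the required
        \<open>z\<close>.\<close>
      moreover have "Q (infdist x ?U) ?h"
      proof -
        have "\<exists>z\<in>F x. dist y z \<le> ?h" if "y \<in> F a" for y
        proof -
          have "F x \<noteq> {}" using x assms(10) unfolding mdom_def by auto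
          then obtain z where "z \<in> F x" "infdist y (F x) = dist y z"
            using infdist_attains_inf[OF compact_imp_closed[OF assms(5)]] by metis
          then show ?thesis
            using infdist_le_hausdorff_dist[OF assms(5) that, of "F x"] by auto
        qed
        then show ?thesis
          unfolding Q_iff using h x infdist_le[of _ ?U x] by blast
      qed
      ultimately show ?thesis
        using m_le order_trans by blast
    qed
  qed
  then show ?thesis using \<phi> by blast
qed

end
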